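(* Let $\varphi_1,\varphi_2:\mathbb{R}^p\to\mathbb{R}\cup\{\infty\}$ and $\varphi=\varphi_1+\varphi_2$, and suppose that either the "smooth case" assumption or the "strongly convex case" assumption (both defined in the context) holds. Consider the (possibly infinite) iterates generated by Algorithm 1 (defined in the context) with tolerance $\varepsilon=0$. Then the sequence of squared residuals $(\|r^k\|^2)_{k}$ has finite sum. Moreover: In the smooth case: (i) The sequences $(u^k)_k$ and $(v^k)_k$ have the same cluster points. Every such cluster point $u_\star$ is stationary for $\varphi$ (i.e. $0\in\partial\varphi(u_\star)$) and satisfies $\varphi(u_\star)=\varphi_\gamma^{\rm DR}(s_\star)$ with $s_\star:=u_\star+\gamma\nabla\varphi_1(u_\star)$; this value is the same for all cluster points, being the limit of the monotonic sequence $(\varphi_\gamma^{\rm DR}(s^k))_k$. (ii) If $\varphi$ is level bounded, then $(s^k,u^k,v^k)_k$ remains bounded. In the strongly convex case: (iii) $\varphi_\gamma^{\rm DR}(s^k)\nearrow\min\varphi$ as $k\to\infty$, and $(u^k)_k$ and $(v^k)_k$ converge to the unique (global) minimizer $x_\star$ of $\varphi$. (iv) If $0\in\operatorname{int}(\operatorname{dom}\varphi_1-\operatorname{dom}\varphi_2)$ (equivalently, if the dual cost $\psi(y):=\varphi_1^*(-y)+\varphi_2^*(y)$ is level bounded), then $(s^k)_k$ is bounded.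
   Context: Smooth case assumption: $\varphi_1:\mathbb{R}^p\to\mathbb{R}$ is differentiable with $L_{\varphi_1}$-Lipschitz continuous gradient; $\varphi_2:\mathbb{R}^p\to\mathbb{R}\cup\{\infty\}$ is lower semicontinuous (lsc); $\operatorname{argmin}\varphi\neq\emptyset$. Strongly convex case assumption: $\varphi_1:\mathbb{R}^p\to\mathbb{R}\cup\{\infty\}$ is proper, lsc and $\mu_{\varphi_1}$-strongly convex ($\varphi_1-\frac{\mu_{\varphi_1}}2\|\cdot\|^2$ is convex, $\mu_{\varphi_1}>0$); $\varphi_2:\mathbb{R}^p\to\mathbb{R}\cup\{\infty\}$ is proper, lsc and convex; $0\in\operatorname{relint}(\operatorname{dom}\varphi_1-\operatorname{dom}\varphi_2)$. Notation: $\hat\partial h$ is the regular (Fréchet) subdifferential, i.e. $v\in\hat\partial h(\bar x)$ iff $\liminf_{\bar x\ne x\to\bar x}\frac{h(x)-h(\bar x)-\langle v,x-\bar x\rangle}{\|x-\bar x\|}\ge0$; $\partial h$ is the limiting subdifferential: $v\in\partial h(x)$ iff $x\in\operatorname{dom}h$ and there are $v^k\in\hat\partial h(x^k)$ with $(x^k,h(x^k),v^k)\to(x,h(x),v)$. $h^*$ is the convex conjugate. A function is level bounded if all its sublevel sets $\{h\le\alpha\}$, $\alpha\in\mathbb{R}$, are bounded. For $\gamma>0$, $\operatorname{prox}_{\gamma h}(x)=\operatorname{argmin}_w\{h(w)+\frac1{2\gamma}\|w-x\|^2\}$. The DRS oracle is $\mathrm{DRS}_\gamma(s)=\{(u,v):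 u\in\operatorname{prox}_{\gamma\varphi_1}(s),\ v\in\operatorname{prox}_{\gamma\varphi_2}(2u-s)\}$. The Douglas–Rachford envelope is $$\varphi_\gamma^{\rm DR}(s)=\varphi_1(u)+\varphi_2(v)+\tfrac1\gamma\langle s-u,v-u\rangle+\tfrac1{2\gamma}\|v-u\|^2,\quad (u,v)\in\mathrm{DRS}_\gamma(s),$$ whose value does not depend on the choice of $(u,v)$ under the standing stepsize restrictions below. Constant: $C(\alpha,\lambda)=\frac{\lambda}{(1+\alpha)^2}\bigl(\frac{2-\lambda}{2}-\alpha\,m\bigr)$, where $m=\max\{\alpha-\frac\lambda2,0\}$ if $\varphi_1$ is convex and $m=1$ otherwise. Algorithm 1 (linesearch DRS). Inputs: $s^0\in\mathbb{R}^p$, tolerance $\varepsilon$, relaxation $\lambda\in(0,2)$, maximum number of backtracks $i_{\max}\in\mathbb{N}\cup\{\infty\}$. In the smooth case set $\pi=1$, take $0<\gamma<1/L_{\varphi_1}$ if $\varphi_1$ is convex and $0<\gamma<\frac{2-\lambda}{2L_{\varphi_1}}$ otherwise, and $0<c<C(\gamma L_{\varphi_1},\lambda)$. In the strongly convex case set $\pi=-1$, take $\gamma>1/\mu_{\varphi_1}$ and $0<c<C(1/(\gamma\mu_{\varphi_1}),\lambda)$. Initialize $k=0$ and $(u^0,v^0)\in\mathrm{DRS}_\gamma(s^0)$. (1) $r^k=u^k-v^k$; if $\frac1\gamma\|r^k\|\le\varepsilon$, stop and return $(s^k,u^k,v^k)$. (2) $\bar s^{k+1}=s^k-\lambda r^k$.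 (3) Select an arbitrary direction $d^k\in\mathbb{R}^p$; set $\tau_k=1$, $i_k=0$. (4) $s^{k+1}=(1-\tau_k)\bar s^{k+1}+\tau_k(s^k+d^k)$. (5) Compute $(u^{k+1},v^{k+1})\in\mathrm{DRS}_\gamma(s^{k+1})$. (6) If $\pi\varphi_\gamma^{\rm DR}(s^{k+1})\le\pi\varphi_\gamma^{\rm DR}(s^k)-\frac c\gamma\|r^k\|^2$: $k\leftarrow k+1$ and go to (1). (7) Otherwise, if $i_k=i_{\max}$: set $s^{k+1}=\bar s^{k+1}$, $(u^{k+1},v^{k+1})\in\mathrm{DRS}_\gamma(s^{k+1})$, $k\leftarrow k+1$ and go to (1). (8) Otherwise (backtrack): $\tau_k\leftarrow\tau_k/2$, $i_k\leftarrow i_k+1$ and go to (4). If a run stops at a finite iteration $K$, the sequences are regarded as constant from $K$ on. *)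

theory Defs
  imports "HOL-Analysis.Analysis"
begin

text \<open>
  Extended-real-valued functions have codomain \<open>ereal\<close>; functions into the reals with plus infinity
  are those that never take the value minus infinity, which is always assumed separately.
\<close>

definition eff_dom :: "('a \<Rightarrow> ereal) \<Rightarrow> 'a set" where
  "eff_dom h = {x. h x < \<infinity>}"

definition proper_fun :: "('a \<Rightarrow> ereal) \<Rightarrow> bool" where
  "proper_fun h \<longleftrightarrow> (\<forall>x. h x \<noteq> -\<infinity>) \<and> (\<exists>x. h x < \<infinity>)"

definition lsc :: "('a::topological_space \<Rightarrow> ereal) \<Rightarrow> bool" where
  "lsc h \<longleftrightarrow> (\<forall>x. h x \<le> Liminf (at x) h)"

text \<open>Only used for functions that avoid minus infinity, so the sum on the right is never of the
  form \<open>\<infinity> - \<infinity>\<close>.\<close>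

definition convex_fun :: "('a::real_vector \<Rightarrow> ereal) \<Rightarrow> bool" where
  "convex_fun h \<longleftrightarrow>
     (\<forall>x y. \<forall>t\<in>{0<..<1::real}.
        h ((1 - t) *\<^sub>R x + t *\<^sub>R y) \<le> ereal (1 - t) * h x + ereal t * h y)"

definition strongly_convex_fun :: "real \<Rightarrow> ('a::real_normed_vector \<Rightarrow> ereal) \<Rightarrow> bool" where
  "strongly_convex_fun \<mu> h \<longleftrightarrow> \<mu> > 0 \<and> convex_fun (\<lambda>x. h x - ereal (\<mu> / 2 * (norm x)\<^sup>2))"

definition level_bounded :: "('a::metric_space \<Rightarrow> ereal) \<Rightarrow> bool" where
  "level_bounded h \<longleftrightarrow> (\<forall>\<alpha>::real. bounded {x. h x \<le> ereal \<alpha>})"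

text \<open>Usual convention of variational analysis: a function that is identically infinite has no
  minimizers.\<close>

definition argmin :: "('a \<Rightarrow> ereal) \<Rightarrow> 'a set" where
  "argmin h = {x. h x < \<infinity> \<and> (\<forall>y. h x \<le> h y)}"

definition conjugate :: "('a::real_inner \<Rightarrow> ereal) \<Rightarrow> 'a \<Rightarrow> ereal" where
  "conjugate h y = (SUP x. ereal (y \<bullet> x) - h x)"

definition gradient :: "('a::real_inner \<Rightarrow> real) \<Rightarrow> 'a \<Rightarrow> 'a" where
  "gradient f x = (THE D. GDERIV f x :> D)"

definition set_diff :: "'a::group_add set \<Rightarrow> 'a set \<Rightarrow> 'a set" where
  "set_diff A B = {a - b | a b. a \<in> A \<and> b \<in> B}"

definition cluster_points :: "(nat \<Rightarrow> 'a::topological_space) \<Rightarrow> 'a set" where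
  "cluster_points X = {l. \<exists>r. strict_mono r \<and> (X \<circ> r) \<longlonglongrightarrow> l}"

text \<open>The value at the reference point has to be finite; without this requirement the junk value
  \<open>\<infinity> - \<infinity> = \<infinity>\<close> of type \<open>ereal\<close> would make every vector a regular subgradient outside of the
  domain.\<close>

definition regular_subdiff :: "('a::real_inner \<Rightarrow> ereal) \<Rightarrow> 'a \<Rightarrow> 'a set" where
  "regular_subdiff h a =
     {v. \<bar>h a\<bar> \<noteq> \<infinity> \<and>
         0 \<le> Liminf (at a) (\<lambda>x. (h x - h a - ereal (v \<bullet> (x - a))) / ereal (norm (x - a)))}"

definition limiting_subdiff :: "('a::real_inner \<Rightarrow> ereal) \<Rightarrow> 'a \<Rightarrow> 'a set" where
  "limiting_subdiff h x =
     {v. x \<in> eff_dom h \<and>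
         (\<exists>X V. (\<forall>k::nat. V k \<in> regular_subdiff h (X k)) \<and>
                X \<longlonglongrightarrow> x \<and> (\<lambda>k. h (X k)) \<longlonglongrightarrow> h x \<and> V \<longlonglongrightarrow> v)}"

definition prox :: "real \<Rightarrow> ('a::real_normed_vector \<Rightarrow> ereal) \<Rightarrow> 'a \<Rightarrow> 'a set" where
  "prox \<gamma> h x = argmin (\<lambda>w. h w + ereal (1 / (2 * \<gamma>) * (norm (w - x))\<^sup>2))"

definition DRS :: "real \<Rightarrow> ('a::real_inner \<Rightarrow> ereal) \<Rightarrow> ('a \<Rightarrow> ereal) \<Rightarrow> 'a \<Rightarrow> ('a \<times> 'a) set" where
  "DRS \<gamma> \<phi>1 \<phi>2 s = {(u, v). u \<in> prox \<gamma> \<phi>1 s \<and> v \<in> prox \<gamma> \<phi>2 (2 *\<^sub>R u - s)}"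

text \<open>The Douglas--Rachford envelope. Under the stepsize restrictions below, its value is the same
  for all pairs \<open>(u, v)\<close> returned by the oracle, so the choice made here is immaterial.\<close>

definition DRE :: "real \<Rightarrow> ('a::real_inner \<Rightarrow> ereal) \<Rightarrow> ('a \<Rightarrow> ereal) \<Rightarrow> 'a \<Rightarrow> ereal" where
  "DRE \<gamma> \<phi>1 \<phi>2 s =
     (let (u, v) = (SOME p. p \<in> DRS \<gamma> \<phi>1 \<phi>2 s)
      in \<phi>1 u + \<phi>2 v + ereal (1 / \<gamma> * ((s - u) \<bullet> (v - u)) + 1 / (2 * \<gamma>) * (norm (v - u))\<^sup>2))"

definition smooth_case :: "real \<Rightarrow> ('a::euclidean_space \<Rightarrow> ereal) \<Rightarrow> ('a \<Rightarrow> ereal) \<Rightarrow> bool" where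
  "smooth_case L \<phi>1 \<phi>2 \<longleftrightarrow>
     (\<forall>x. \<bar>\<phi>1 x\<bar> \<noteq> \<infinity>) \<and>
     (\<forall>x. (\<lambda>y. real_of_ereal (\<phi>1 y)) differentiable (at x)) \<and>
     L-lipschitz_on UNIV (gradient (\<lambda>y. real_of_ereal (\<phi>1 y))) \<and>
     (\<forall>x. \<phi>2 x \<noteq> -\<infinity>) \<and> lsc \<phi>2 \<and>
     argmin (\<lambda>x. \<phi>1 x + \<phi>2 x) \<noteq> {}"

definition strongly_convex_case ::
    "real \<Rightarrow> ('a::euclidean_space \<Rightarrow> ereal) \<Rightarrow> ('a \<Rightarrow> ereal) \<Rightarrow> bool" where
  "strongly_convex_case \<mu> \<phi>1 \<phi>2 \<longleftrightarrow>
     proper_fun \<phi>1 \<and> lsc \<phi>1 \<and> strongly_convex_fun \<mu> \<phi>1 \<and>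
     proper_fun \<phi>2 \<and> lsc \<phi>2 \<and> convex_fun \<phi>2 \<and>
     0 \<in> rel_interior (set_diff (eff_dom \<phi>1) (eff_dom \<phi>2))"

definition C_const :: "('a::real_vector \<Rightarrow> ereal) \<Rightarrow> real \<Rightarrow> real \<Rightarrow> real" where
  "C_const \<phi>1 \<alpha> lam =
     (let m = (if convex_fun \<phi>1 then max (\<alpha> - lam / 2) 0 else 1)
      in lam / (1 + \<alpha>)\<^sup>2 * ((2 - lam) / 2 - \<alpha> * m))"

text \<open>The upper bounds \<open>1 / L\<close> and \<open>(2 - lam) / (2 * L)\<close> on the stepsize are multiplied out, so that
  they are read as infinity, rather than zero, for \<open>L = 0\<close>.\<close>

definition smooth_params ::
    "real \<Rightarrow> ('a::euclidean_space \<Rightarrow> ereal) \<Rightarrow> real \<Rightarrow> real \<Rightarrow> real \<Rightarrow> bool" where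
  "smooth_params L \<phi>1 \<gamma> lam c \<longleftrightarrow>
     0 < \<gamma> \<and> (if convex_fun \<phi>1 then \<gamma> * L < 1 else \<gamma> * (2 * L) < 2 - lam) \<and>
     0 < c \<and> c < C_const \<phi>1 (\<gamma> * L) lam"

definition strongly_convex_params ::
    "real \<Rightarrow> ('a::euclidean_space \<Rightarrow> ereal) \<Rightarrow> real \<Rightarrow> real \<Rightarrow> real \<Rightarrow> bool" where
  "strongly_convex_params \<mu> \<phi>1 \<gamma> lam c \<longleftrightarrow>
     1 / \<mu> < \<gamma> \<and> 0 < c \<and> c < C_const \<phi>1 (1 / (\<gamma> * \<mu>)) lam"

text \<open>The candidate after \<open>i\<close> backtracks, that is, with linesearch stepsize \<open>\<tau> = 1 / 2 ^ i\<close>;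
  \<open>sbar\<close> is the nominal update and \<open>d\<close> the selected direction.\<close>

definition trial :: "'a::real_vector \<Rightarrow> 'a \<Rightarrow> 'a \<Rightarrow> nat \<Rightarrow> 'a" where
  "trial s sbar d i = (1 - 1 / 2 ^ i) *\<^sub>R sbar + (1 / 2 ^ i) *\<^sub>R (s + d)"

definition sufficient_progress ::
    "real \<Rightarrow> real \<Rightarrow> real \<Rightarrow> ('a::real_inner \<Rightarrow> ereal) \<Rightarrow> ('a \<Rightarrow> ereal) \<Rightarrow> 'a \<Rightarrow> 'a \<Rightarrow> 'a \<Rightarrow> bool"
  where
  "sufficient_progress \<pi> \<gamma> c \<phi>1 \<phi>2 s r s' \<longleftrightarrow>
     ereal \<pi> * DRE \<gamma> \<phi>1 \<phi>2 s' \<le> ereal \<pi> * DRE \<gamma> \<phi>1 \<phi>2 s - ereal (c / \<gamma> * (norm r)\<^sup>2)"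

text \<open>The possible values \<open>s'\<close> of the next governing iterate produced by the linesearch: after
  \<open>i \<le> imax\<close> backtracks (all previous trial points being rejected), either the current trial point
  is accepted, or it is rejected, \<open>i\<close> is maximal and the nominal step is taken.\<close>

definition linesearch_next ::
    "real \<Rightarrow> real \<Rightarrow> real \<Rightarrow> enat \<Rightarrow> ('a::real_inner \<Rightarrow> ereal) \<Rightarrow> ('a \<Rightarrow> ereal)
      \<Rightarrow> 'a \<Rightarrow> 'a \<Rightarrow> 'a \<Rightarrow> 'a \<Rightarrow> 'a \<Rightarrow> bool" where
  "linesearch_next \<pi> \<gamma> c imax \<phi>1 \<phi>2 s r sbar d s' \<longleftrightarrow>
     (\<exists>i. enat i \<le> imax \<and>
          (\<forall>j<i. \<not> sufficient_progress \<pi> \<gamma> c \<phi>1 \<phi>2 s r (trial s sbar d j)) \<and>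
          (if sufficient_progress \<pi> \<gamma> c \<phi>1 \<phi>2 s r (trial s sbar d i)
           then s' = trial s sbar d i
           else enat i = imax \<and> s' = sbar))"

text \<open>\<open>(s, u, v)\<close> are iterates of the linesearch Douglas--Rachford algorithm with tolerance \<open>\<epsilon>\<close>,
  extended as constant sequences once the stopping criterion is met.\<close>

definition linesearch_DRS ::
    "real \<Rightarrow> real \<Rightarrow> real \<Rightarrow> real \<Rightarrow> real \<Rightarrow> enat \<Rightarrow> ('a::real_inner \<Rightarrow> ereal) \<Rightarrow> ('a \<Rightarrow> ereal)
      \<Rightarrow> (nat \<Rightarrow> 'a) \<Rightarrow> (nat \<Rightarrow> 'a) \<Rightarrow> (nat \<Rightarrow> 'a) \<Rightarrow> bool" where
  "linesearch_DRS \<pi> \<gamma> lam c \<epsilon> imax \<phi>1 \<phi>2 s u v \<longleftrightarrow>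
     (u 0, v 0) \<in> DRS \<gamma> \<phi>1 \<phi>2 (s 0) \<and>
     (\<forall>k. let r = u k - v k; sbar = s k - lam *\<^sub>R r in
        if 1 / \<gamma> * norm r \<le> \<epsilon>
        then s (Suc k) = s k \<and> u (Suc k) = u k \<and> v (Suc k) = v k
        else (\<exists>d. linesearch_next \<pi> \<gamma> c imax \<phi>1 \<phi>2 (s k) r sbar d (s (Suc k))) \<and>
             (u (Suc k), v (Suc k)) \<in> DRS \<gamma> \<phi>1 \<phi>2 (s (Suc k)))"

end

theory Submission
  imports Defs
begin

text \<open>
  Let \<open>r = u - v\<close> be the residual and \<open>y = (s - u) / \<gamma>\<close>. The envelope is a merit function: in every iteration
  it decreases (smooth case) or increases (strongly convex case) by at least \<open>(c / \<gamma>) \<parallel>r\<parallel>\<^sup>2\<close>. Accepted trial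
  points satisfy this by the acceptance test, so only the nominal step from \<open>s\<close> to \<open>s' = s - \<lambda>r\<close> has to be
  examined (\<open>linesearch_DRS_merit_step\<close>). Let \<open>X = u' - u\<close> and \<open>Y = \<gamma>(y' - y)\<close>, so that \<open>X + Y = - \<lambda>r\<close>. In
  the smooth case \<open>y\<close> is the gradient of \<open>\<phi>1\<close> at \<open>u\<close>, and \<open>\<parallel>Y\<parallel> \<le> \<gamma>L \<parallel>X\<parallel>\<close>; in the strongly convex case
  \<open>\<parallel>X\<parallel> \<le> \<parallel>Y\<parallel> / (\<gamma>\<mu>)\<close>. Up to exchanging \<open>X\<close> and \<open>Y\<close>, both cases lead to one inequality between these two
  vectors, \<open>relaxed_step_gain\<close>. The envelope is also bounded, by \<open>min \<phi>\<close> from below or by the values of \<open>\<phi>\<close>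
  from above (\<open>smooth_envelope_lower_bound\<close>, \<open>strongly_convex_envelope_gap\<close>), whence the squared residuals
  are summable and the envelope converges.

  In the smooth case, let \<open>x\<close> be a cluster point of \<open>u\<close>, hence of \<open>v\<close>. In the limit \<open>(x, x)\<close> is a pair
  returned by the oracle at \<open>x + \<gamma>\<nabla>\<phi>1(x)\<close>, the envelope there has the value \<open>\<phi>(x)\<close>, and this is the limit of
  the envelope along the iterates (\<open>smooth_DRS_limit\<close>). The optimality conditions of the two proximal steps
  at this fixed point give a quadratic minorant of \<open>\<phi>\<close> with slope zero at \<open>x\<close>
  (\<open>smooth_fixed_point_stationary\<close>).

  In the strongly convex case, \<open>y\<close> and \<open>r / \<gamma> - y\<close> are subgradients of \<open>\<phi>1\<close> at \<open>u\<close> and of \<open>\<phi>2\<close> at \<open>v\<close>. The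
  envelope differs from \<open>\<phi>1(u) + \<phi>2(v)\<close> by \<open>- y \<bullet> r\<close> and a multiple of \<open>\<parallel>r\<parallel>\<^sup>2\<close>, and the difficulty is that
  \<open>y\<close> may be unbounded. Testing the two subgradient inequalities at points of the two domains with
  difference \<open>w\<close> bounds \<open>y \<bullet> w\<close>. As zero is a relative interior point of \<open>dom \<phi>1 - dom \<phi>2\<close>, all small \<open>w\<close> in
  the span of this set qualify, so \<open>y\<close> is bounded on a subspace that contains every residual
  (\<open>strongly_convex_splitting_dual_bounded\<close>). Thus \<open>y \<bullet> r\<close> tends to zero, and lower semicontinuity yields a
  point whose cost is the limit of the envelope; the gap between cost and envelope bounds the distance of \<open>u\<close>
  to it (\<open>strongly_convex_splitting_convergence\<close>). If zero is an interior point, the span is the whole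
  space, \<open>y\<close> is bounded, and so is \<open>s = u + \<gamma>y\<close>. The same test bounds the sublevel sets of the dual cost;
  if zero is not an interior point, the dual cost is constant along a direction orthogonal to
  \<open>dom \<phi>1 - dom \<phi>2\<close> (\<open>dual_level_bounded_iff\<close>).
\<close>

section \<open>Lower semicontinuity along sequences\<close>

lemma lsc_eventually_greater:
  fixes h :: "'a::topological_space \<Rightarrow> ereal"
  assumes "lsc h" "b < h x" "X \<longlonglongrightarrow> x"
  shows "\<forall>\<^sub>F n in sequentially. b < h (X n)"
proof -
  have "h x \<le> Liminf (at x) h"
    using assms(1) by (simp add: lsc_def)
  then have "\<forall>\<^sub>F y in at x. b < h y"
    using assms(2) by (auto simp: le_Liminf_iff)
  then have "\<forall>\<^sub>F y in nhds x. b < h y"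
    using assms(2) by (simp add: eventually_nhds_conv_at)
  then show ?thesis
    using assms(3) by (auto simp: filterlim_iff)
qed

lemma lsc_le_liminf:
  fixes h :: "'a::topological_space \<Rightarrow> ereal"
  assumes "lsc h" "X \<longlonglongrightarrow> x"
  shows "h x \<le> liminf (\<lambda>n. h (X n))"
  using lsc_eventually_greater[OF assms(1) _ assms(2)] by (auto simp: le_Liminf_iff)

lemma lsc_le_limit:
  fixes h :: "'a::topological_space \<Rightarrow> ereal"
  assumes "lsc h" "X \<longlonglongrightarrow> x" "\<And>n. h (X n) \<le> ereal (a n)" "a \<longlonglongrightarrow> l"
  shows "h x \<le> ereal l"
proof -
  have "h x \<le> liminf (\<lambda>n. h (X n))"
    by (rule lsc_le_liminf[OF assms(1,2)])
  also have "\<dots> \<le> liminf (\<lambda>n. ereal (a n))"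
    using assms(3) by (intro Liminf_mono) auto
  also have "\<dots> = ereal l"
    using assms(4) by (intro lim_imp_Liminf) auto
  finally show ?thesis .
qed

text \<open>
  Lower semicontinuity is applied to the two functions separately, along different sequences: in the
  convergence proof \<open>h1\<close> is evaluated at the points \<open>u\<close> and \<open>h2\<close> at the points \<open>v\<close>, where only the sum
  of the two values is known to converge.
\<close>

lemma lsc_add_le_limit:
  fixes h1 h2 :: "'a::topological_space \<Rightarrow> ereal"
  assumes "lsc h1" "lsc h2" and no_minf: "h1 x \<noteq> -\<infinity>" "h2 x \<noteq> -\<infinity>"
    and "X \<longlonglongrightarrow> x" "Y \<longlonglongrightarrow> x" "\<And>n. h1 (X n) + h2 (Y n) \<le> ereal (a n)" "a \<longlonglongrightarrow> l"
  shows "h1 x + h2 x \<le> ereal l"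
proof -
  have 1: "h1 x \<le> liminf (\<lambda>n. h1 (X n))" and 2: "h2 x \<le> liminf (\<lambda>n. h2 (Y n))"
    using assms by (auto intro: lsc_le_liminf)
  then have "h1 x + h2 x \<le> liminf (\<lambda>n. h1 (X n)) + liminf (\<lambda>n. h2 (Y n))"
    by (rule add_mono)
  also have "\<dots> \<le> liminf (\<lambda>n. h1 (X n) + h2 (Y n))"
    using 1 2 no_minf by (intro ereal_liminf_add_mono) auto
  also have "\<dots> \<le> liminf (\<lambda>n. ereal (a n))"
    using assms(7) by (intro Liminf_mono) auto
  also have "\<dots> = ereal l"
    using assms(8) by (intro lim_imp_Liminf) auto
  finally show ?thesis .
qed

section \<open>Functions with Lipschitz continuous gradient\<close>

text \<open>
  The descent lemma: along the segment from \<open>x\<close> to \<open>y\<close> the error of the linearization, minus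
  the quadratic term, has nonpositive derivative.
\<close>

lemma lipschitz_gradient_upper_bound:
  fixes f :: "'a::real_inner \<Rightarrow> real"
  assumes deriv: "\<And>x. (f has_derivative (\<lambda>h. G x \<bullet> h)) (at x)"
    and lip: "L-lipschitz_on UNIV G"
  shows "f y \<le> f x + G x \<bullet> (y - x) + L / 2 * (norm (y - x))\<^sup>2"
proof -
  define d where "d = y - x"
  define p where "p t = f (x + t *\<^sub>R d) - t * (G x \<bullet> d) - L / 2 * t\<^sup>2 * (norm d)\<^sup>2" for t
  have p_deriv: "(p has_real_derivative G (x + t *\<^sub>R d) \<bullet> d - G x \<bullet> d - L * t * (norm d)\<^sup>2) (at t)" for t
  proof -
    have "((\<lambda>t. x + t *\<^sub>R d) has_derivative (\<lambda>h. h *\<^sub>R d)) (at t)"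
      by (auto intro!: derivative_eq_intros)
    from has_derivative_compose[OF this deriv]
    have "((\<lambda>t. f (x + t *\<^sub>R d)) has_real_derivative G (x + t *\<^sub>R d) \<bullet> d) (at t)"
      by (simp add: has_field_derivative_def o_def mult_commute_abs)
    then show ?thesis
      unfolding p_def by (auto intro!: derivative_eq_intros)
  qed
  have "p 1 \<le> p 0"
  proof (rule DERIV_nonpos_imp_nonincreasing[where f = p])
    fix t :: real assume t: "0 \<le> t" "t \<le> 1"
    have "(G (x + t *\<^sub>R d) - G x) \<bullet> d \<le> norm (G (x + t *\<^sub>R d) - G x) * norm d"
      by (rule norm_cauchy_schwarz)
    also have "\<dots> \<le> L * norm (t *\<^sub>R d) * norm d"
      using lipschitz_onD[OF lip, of "x + t *\<^sub>R d" x] by (intro mult_right_mono) (auto simp: dist_norm)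
    also have "\<dots> = L * t * (norm d)\<^sup>2"
      using t by (simp add: power2_eq_square)
    finally have "G (x + t *\<^sub>R d) \<bullet> d - G x \<bullet> d - L * t * (norm d)\<^sup>2 \<le> 0"
      by (simp add: inner_diff_left)
    with p_deriv show "\<exists>D. DERIV p t :> D \<and> D \<le> 0"
      by blast
  qed simp
  then show ?thesis
    by (simp add: p_def d_def)
qed

lemma lipschitz_gradient_lower_bound:
  fixes f :: "'a::real_inner \<Rightarrow> real"
  assumes deriv: "\<And>x. (f has_derivative (\<lambda>h. G x \<bullet> h)) (at x)"
    and lip: "L-lipschitz_on UNIV G"
  shows "f x + G x \<bullet> (y - x) - L / 2 * (norm (y - x))\<^sup>2 \<le> f y"
proof -
  have "((\<lambda>x. - f x) has_derivative (\<lambda>h. (- G x) \<bullet> h)) (at x)" for x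
    using has_derivative_minus[OF deriv] by simp
  moreover have "L-lipschitz_on UNIV (\<lambda>x. - G x)"
    using lip by (simp add: lipschitz_on_def dist_norm norm_minus_commute)
  ultimately show ?thesis
    using lipschitz_gradient_upper_bound[of "\<lambda>x. - f x" "\<lambda>x. - G x" L y x] by simp
qed

lemma convex_gradient_inequality:
  fixes f :: "'a::real_inner \<Rightarrow> real"
  assumes deriv: "(f has_derivative (\<lambda>h. D \<bullet> h)) (at x)"
    and conv: "convex_on UNIV f"
  shows "f x + D \<bullet> (y - x) \<le> f y"
proof -
  define q where "q t = f (x + t *\<^sub>R (y - x))" for t :: real
  have "((\<lambda>t. x + t *\<^sub>R (y - x)) has_derivative (\<lambda>h. h *\<^sub>R (y - x))) (at 0)"
    by (auto intro!: derivative_eq_intros)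
  moreover have "(f has_derivative (\<lambda>h. D \<bullet> h)) (at (x + 0 *\<^sub>R (y - x)))"
    using deriv by simp
  ultimately have "((\<lambda>t. f (x + t *\<^sub>R (y - x))) has_derivative (\<lambda>h. D \<bullet> (h *\<^sub>R (y - x)))) (at 0)"
    by (rule has_derivative_compose)
  then have "(q has_real_derivative D \<bullet> (y - x)) (at 0)"
    unfolding q_def by (simp add: has_field_derivative_def mult_commute_abs)
  then have "((\<lambda>t. (q t - q 0) / t) \<longlongrightarrow> D \<bullet> (y - x)) (at_right 0)"
    by (auto simp: DERIV_def intro: filterlim_mono[OF _ order_refl at_le])
  moreover have "\<forall>\<^sub>F t in at_right 0. (q t - q 0) / t \<le> f y - f x"
  proof -
    have "(q t - q 0) / t \<le> f y - f x" if "0 < t" "t < 1" for t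
    proof -
      have "q t \<le> (1 - t) * f x + t * f y"
        using convex_onD[OF conv, of t x y] that by (simp add: q_def algebra_simps)
      then have "q t - q 0 \<le> (f y - f x) * t"
        by (simp add: q_def algebra_simps)
      with that show ?thesis
        by (simp add: divide_le_eq)
    qed
    then show ?thesis
      by (auto simp: eventually_at_right_field intro!: exI[of _ 1])
  qed
  ultimately have "D \<bullet> (y - x) \<le> f y - f x"
    by (rule tendsto_upperbound) simp
  then show ?thesis
    by simp
qed

text \<open>
  The Baillon--Haddad inequality. The convex function \<open>f - G y \<bullet> _\<close> is minimal at \<open>y\<close>, and a gradient
  step of length \<open>1 / L\<close> from \<open>x\<close> lowers it by the square term.
\<close>

lemma convex_gradient_cocoercive:
  fixes f :: "'a::real_inner \<Rightarrow> real"
  assumes deriv: "\<And>x. (f has_derivative (\<lambda>h. G x \<bullet> h)) (at x)"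
    and lip: "L-lipschitz_on UNIV G"
    and conv: "convex_on UNIV f"
  shows "f y + G y \<bullet> (x - y) + (norm (G x - G y))\<^sup>2 / (2 * L) \<le> f x"
proof (cases "L = 0")
  case True
  then show ?thesis
    using convex_gradient_inequality[OF deriv conv, of y x] by simp
next
  case False
  then have L: "0 < L"
    using lipschitz_on_nonneg[OF lip] by simp
  \<comment> \<open>The gradient step from \<open>x\<close> for the function \<open>f - G y \<bullet> _\<close>.\<close>
  define w where "w = x - (1 / L) *\<^sub>R (G x - G y)"
  have "f y + G y \<bullet> (w - y) \<le> f w"
    by (rule convex_gradient_inequality[OF deriv conv])
  also have "f w \<le> f x + G x \<bullet> (w - x) + L / 2 * (norm (w - x))\<^sup>2"
    by (rule lipschitz_gradient_upper_bound[OF deriv lip])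
  finally have "f y + G y \<bullet> (w - y) \<le> f x + G x \<bullet> (w - x) + L / 2 * (norm (w - x))\<^sup>2" .
  moreover have "w - x = - (1 / L) *\<^sub>R (G x - G y)"
    by (simp add: w_def)
  moreover have "G y \<bullet> (w - y) = G y \<bullet> (w - x) + G y \<bullet> (x - y)"
    by (simp add: inner_diff_right)
  moreover have "G x \<bullet> (w - x) - G y \<bullet> (w - x) = - (norm (G x - G y))\<^sup>2 / L"
    unfolding \<open>w - x = _\<close> inner_diff_left[symmetric] by (simp add: power2_norm_eq_inner)
  moreover have "L / 2 * (norm (w - x))\<^sup>2 = (norm (G x - G y))\<^sup>2 / (2 * L)"
    using L unfolding \<open>w - x = _\<close> by (simp add: power2_eq_square)
  moreover have "(norm (G x - G y))\<^sup>2 / L = 2 * ((norm (G x - G y))\<^sup>2 / (2 * L))"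
    by simp
  ultimately show ?thesis
    by linarith
qed

lemma has_derivative_gradient:
  fixes f :: "'a::euclidean_space \<Rightarrow> real"
  assumes "f differentiable (at x)"
  shows "(f has_derivative (\<lambda>h. gradient f x \<bullet> h)) (at x)"
proof -
  obtain f' where f': "(f has_derivative f') (at x)"
    using assms by (auto simp: differentiable_def)
  then interpret f': linear f'
    by (rule has_derivative_linear)
  define D where "D = (\<Sum>b\<in>Basis. f' b *\<^sub>R b)"
  have "f' h = h \<bullet> D" for h
  proof -
    have "f' h = f' (\<Sum>b\<in>Basis. (h \<bullet> b) *\<^sub>R b)"
      by (simp add: euclidean_representation)
    also have "\<dots> = h \<bullet> D"
      by (simp add: D_def f'.sum f'.scaleR inner_sum_right mult.commute)
    finally show ?thesis .
  qed
  then have D: "GDERIV f x :> D"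
    using f' by (simp add: gderiv_def ext[of f' "\<lambda>h. h \<bullet> D"])
  have "D' = D" if "GDERIV f x :> D'" for D'
  proof -
    have "(\<lambda>h. h \<bullet> D') = (\<lambda>h. h \<bullet> D)"
      using that D unfolding gderiv_def by (rule has_derivative_unique)
    then have "(D' - D) \<bullet> (D' - D) = 0"
      by (metis (no_types) inner_diff_right diff_self)
    then show ?thesis
      by simp
  qed
  then have "gradient f x = D"
    unfolding gradient_def using D by (intro the_equality)
  then show ?thesis
    using D by (simp add: gderiv_def inner_commute)
qed

section \<open>Proximal points\<close>

lemma convex_fun_ereal_imp_convex_on:
  assumes "convex_fun (\<lambda>x. ereal (f x))"
  shows "convex_on UNIV f"
proof (rule convex_onI)
  fix t :: real and x y assume "0 < t" "t < 1"
  then have "ereal (f ((1 - t) *\<^sub>R x + t *\<^sub>R y)) \<le> ereal (1 - t) * ereal (f x) + ereal t * ereal (f y)"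
    using assms[unfolded convex_fun_def, rule_format, of t x y] by simp
  then show "f ((1 - t) *\<^sub>R x + t *\<^sub>R y) \<le> (1 - t) * f x + t * f y"
    by simp
qed simp

lemma prox_finite:
  assumes "u \<in> prox \<gamma> h s" "h u \<noteq> -\<infinity>"
  shows "ereal (real_of_ereal (h u)) = h u"
proof -
  have "h u + ereal (1 / (2 * \<gamma>) * (norm (u - s))\<^sup>2) < \<infinity>"
    using assms(1) by (simp add: prox_def argmin_def)
  with assms(2) show ?thesis
    by (cases "h u") auto
qed

lemma prox_le:
  assumes "u \<in> prox \<gamma> h s" "h u \<noteq> -\<infinity>" "h x = ereal b"
  shows "real_of_ereal (h u) + 1 / (2 * \<gamma>) * (norm (u - s))\<^sup>2 \<le> b + 1 / (2 * \<gamma>) * (norm (x - s))\<^sup>2"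
proof -
  have "h u + ereal (1 / (2 * \<gamma>) * (norm (u - s))\<^sup>2) \<le> h x + ereal (1 / (2 * \<gamma>) * (norm (x - s))\<^sup>2)"
    using assms(1) by (simp add: prox_def argmin_def)
  moreover obtain a where "h u = ereal a"
    using prox_finite[OF assms(1,2)] by metis
  ultimately show ?thesis
    by (simp add: assms(3))
qed

lemma proxI:
  assumes "\<And>x. h x \<noteq> -\<infinity>" "h u = ereal a"
    and "\<And>x b. h x = ereal b \<Longrightarrow>
      a + 1 / (2 * \<gamma>) * (norm (u - s))\<^sup>2 \<le> b + 1 / (2 * \<gamma>) * (norm (x - s))\<^sup>2"
  shows "u \<in> prox \<gamma> h s"
proof -
  have "h u + ereal (1 / (2 * \<gamma>) * (norm (u - s))\<^sup>2) \<le> h x + ereal (1 / (2 * \<gamma>) * (norm (x - s))\<^sup>2)" for x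
    using assms(1)[of x] assms(2) assms(3)[of x] by (cases "h x") auto
  then show ?thesis
    using assms(2) by (simp add: prox_def argmin_def)
qed

lemma norm_diff_square:
  fixes a b :: "'a::real_inner"
  shows "(norm (a - b))\<^sup>2 = (norm a)\<^sup>2 - 2 * (a \<bullet> b) + (norm b)\<^sup>2"
  by (simp add: power2_norm_eq_inner inner_diff inner_commute)

lemma norm_sq_convex_combination:
  fixes x y :: "'a::real_inner"
  shows "(norm ((1 - t) *\<^sub>R x + t *\<^sub>R y))\<^sup>2
       = (1 - t) * (norm x)\<^sup>2 + t * (norm y)\<^sup>2 - t * (1 - t) * (norm (y - x))\<^sup>2"
  by (simp add: power2_norm_eq_inner inner_commute algebra_simps)

text \<open>
  The inclusion \<open>(s - u) / \<gamma> \<in> \<partial>h(u)\<close>, with the quadratic term due to strong convexity; \<open>\<mu> = 0\<close> gives the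
  convex case. It follows by comparing \<open>u\<close> with the points \<open>(1 - t) u + t x\<close> and letting \<open>t\<close> tend
  to zero.
\<close>

lemma prox_subgradient:
  fixes h :: "'a::real_inner \<Rightarrow> ereal"
  assumes no_minf: "\<And>x. h x \<noteq> -\<infinity>"
    and conv: "convex_fun (\<lambda>x. h x - ereal (\<mu> / 2 * (norm x)\<^sup>2))"
    and \<gamma>: "0 < \<gamma>" and u: "u \<in> prox \<gamma> h s" and x: "h x = ereal b"
  shows "real_of_ereal (h u) + ((s - u) \<bullet> (x - u)) / \<gamma> + \<mu> / 2 * (norm (x - u))\<^sup>2 \<le> b"
proof -
  define a where "a = real_of_ereal (h u)"
  have a: "h u = ereal a"
    using prox_finite[OF u no_minf] by (simp add: a_def)
  define w where "w t = (1 - t) *\<^sub>R u + t *\<^sub>R x" for t :: real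
  have ineq: "((s - u) \<bullet> (x - u)) / \<gamma> \<le> b - a - \<mu> / 2 * (1 - t) * (norm (x - u))\<^sup>2 + t / (2 * \<gamma>) * (norm (x - u))\<^sup>2"
    if t: "0 < t" "t < 1" for t
  proof -
    have "h (w t) - ereal (\<mu> / 2 * (norm (w t))\<^sup>2)
      \<le> ereal (1 - t) * (h u - ereal (\<mu> / 2 * (norm u)\<^sup>2)) + ereal t * (h x - ereal (\<mu> / 2 * (norm x)\<^sup>2))"
      using conv t unfolding convex_fun_def w_def by auto
    then have 1: "h (w t) - ereal (\<mu> / 2 * (norm (w t))\<^sup>2)
      \<le> ereal ((1 - t) * (a - \<mu> / 2 * (norm u)\<^sup>2) + t * (b - \<mu> / 2 * (norm x)\<^sup>2))"
      by (simp add: a x)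
    then obtain d where d: "h (w t) = ereal d"
      using no_minf[of "w t"] by (cases "h (w t)") auto
    have "d - \<mu> / 2 * (norm (w t))\<^sup>2 \<le> (1 - t) * (a - \<mu> / 2 * (norm u)\<^sup>2) + t * (b - \<mu> / 2 * (norm x)\<^sup>2)"
      using 1 by (simp add: d)
    then have 2: "d \<le> (1 - t) * a + t * b - \<mu> / 2 * (t * (1 - t) * (norm (x - u))\<^sup>2)"
      unfolding w_def norm_sq_convex_combination by (simp add: algebra_simps diff_divide_distrib)
    have 3: "a + 1 / (2 * \<gamma>) * (norm (u - s))\<^sup>2 \<le> d + 1 / (2 * \<gamma>) * (norm (w t - s))\<^sup>2"
      using prox_le[OF u no_minf d] by (simp add: a_def)
    have eq: "w t - s = t *\<^sub>R (x - u) - (s - u)"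
      by (simp add: w_def algebra_simps)
    have "(norm (w t - s))\<^sup>2 = t\<^sup>2 * (norm (x - u))\<^sup>2 - 2 * t * ((s - u) \<bullet> (x - u)) + (norm (u - s))\<^sup>2"
      unfolding eq norm_diff_square[of "t *\<^sub>R (x - u)" "s - u"]
      by (simp add: power_mult_distrib inner_commute[of "x - u"] norm_minus_commute[of s u])
    then have "1 / (2 * \<gamma>) * (norm (w t - s))\<^sup>2
        = t * (t / (2 * \<gamma>) * (norm (x - u))\<^sup>2) - t * (((s - u) \<bullet> (x - u)) / \<gamma>) + 1 / (2 * \<gamma>) * (norm (u - s))\<^sup>2"
      by (simp add: add_divide_distrib diff_divide_distrib power2_eq_square)
    with 2 3 have "t * (((s - u) \<bullet> (x - u)) / \<gamma>)
        \<le> (1 - t) * a + t * b - \<mu> / 2 * (t * (1 - t) * (norm (x - u))\<^sup>2) - a + t * (t / (2 * \<gamma>) * (norm (x - u))\<^sup>2)"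
      by linarith
    also have "\<dots> = t * (b - a - \<mu> / 2 * (1 - t) * (norm (x - u))\<^sup>2 + t / (2 * \<gamma>) * (norm (x - u))\<^sup>2)"
      by (simp add: algebra_simps diff_divide_distrib)
    finally show ?thesis
      using t(1) by (rule mult_left_le_imp_le)
  qed
  have "((\<lambda>t. b - a - \<mu> / 2 * (1 - t) * (norm (x - u))\<^sup>2 + t / (2 * \<gamma>) * (norm (x - u))\<^sup>2)
      \<longlongrightarrow> b - a - \<mu> / 2 * (1 - 0) * (norm (x - u))\<^sup>2 + 0 / (2 * \<gamma>) * (norm (x - u))\<^sup>2) (at_right 0)"
    using \<gamma> by (intro tendsto_intros) auto
  moreover have "\<forall>\<^sub>F t in at_right 0. ((s - u) \<bullet> (x - u)) / \<gamma>
      \<le> b - a - \<mu> / 2 * (1 - t) * (norm (x - u))\<^sup>2 + t / (2 * \<gamma>) * (norm (x - u))\<^sup>2"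
    unfolding eventually_at_right_field using ineq by (intro exI[of _ 1]) auto
  ultimately have "((s - u) \<bullet> (x - u)) / \<gamma> \<le> b - a - \<mu> / 2 * (norm (x - u))\<^sup>2"
    using tendsto_lowerbound by fastforce
  then show ?thesis
    by (simp add: a_def)
qed

lemma prox_differentiable_optimality:
  fixes f :: "'a::real_inner \<Rightarrow> real"
  assumes deriv: "(f has_derivative (\<lambda>h. D \<bullet> h)) (at u)"
    and \<gamma>: "0 < \<gamma>" and u: "u \<in> prox \<gamma> (\<lambda>x. ereal (f x)) s"
  shows "s = u + \<gamma> *\<^sub>R D"
proof -
  define F where "F w = f w + 1 / (2 * \<gamma>) * ((w - s) \<bullet> (w - s))" for w
  have "(F has_derivative (\<lambda>h. D \<bullet> h + 1 / (2 * \<gamma>) * ((u - s) \<bullet> h + h \<bullet> (u - s)))) (at u)"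
    unfolding F_def
    by (intro has_derivative_add deriv has_derivative_mult_right) (auto intro!: derivative_eq_intros)
  moreover have "F u \<le> F w" for w
    using prox_le[OF u, of w "f w"] by (simp add: F_def power2_norm_eq_inner)
  ultimately have "(\<lambda>h. D \<bullet> h + 1 / (2 * \<gamma>) * ((u - s) \<bullet> h + h \<bullet> (u - s))) = (\<lambda>h. 0)"
    by (intro has_derivative_local_min) auto
  then have "(D + (1 / \<gamma>) *\<^sub>R (u - s)) \<bullet> h = 0" for h
    by (drule_tac fun_cong[of _ _ h]) (simp add: inner_add_left inner_diff_left inner_commute[of h] diff_divide_distrib scaleR_diff_right)
  then have "D + (1 / \<gamma>) *\<^sub>R (u - s) = 0"
    using inner_eq_zero_iff by blast
  then have "\<gamma> *\<^sub>R (D + (1 / \<gamma>) *\<^sub>R (u - s)) = 0"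
    by simp
  then show ?thesis
    using \<gamma> by (simp add: algebra_simps)
qed

section \<open>Values of the Douglas--Rachford envelope\<close>

text \<open>
  The envelope as a real number, at a given oracle pair. All points returned by the oracle have finite
  values, so that the conversion of the two values to reals loses nothing there.
\<close>

definition envelope_at ::
    "real \<Rightarrow> ('a::real_inner \<Rightarrow> ereal) \<Rightarrow> ('a \<Rightarrow> ereal) \<Rightarrow> 'a \<Rightarrow> 'a \<Rightarrow> 'a \<Rightarrow> real" where
  "envelope_at \<gamma> \<phi>1 \<phi>2 s u v =
     real_of_ereal (\<phi>1 u) + real_of_ereal (\<phi>2 v)
       + 1 / \<gamma> * ((s - u) \<bullet> (v - u)) + 1 / (2 * \<gamma>) * (norm (v - u))\<^sup>2"

text \<open>
  Completing the square: for fixed \<open>s\<close> and \<open>u\<close>, the envelope depends on \<open>v\<close> only through the objective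
  that \<open>v\<close> minimizes as a proximal point at \<open>2u - s\<close>. This makes its value independent of the choice
  of \<open>v\<close>, and bounds it by the same expression at any other point.
\<close>

lemma envelope_at_prox_form:
  "envelope_at \<gamma> \<phi>1 \<phi>2 s u v =
     real_of_ereal (\<phi>1 u) - 1 / (2 * \<gamma>) * (norm (s - u))\<^sup>2
       + (real_of_ereal (\<phi>2 v) + 1 / (2 * \<gamma>) * (norm (v - (2 *\<^sub>R u - s)))\<^sup>2)"
proof -
  have eq: "v - (2 *\<^sub>R u - s) = (v - u) - (u - s)"
    by (simp add: scaleR_2)
  have "(v - u) \<bullet> (u - s) = - ((s - u) \<bullet> (v - u))"
    by (metis inner_commute inner_minus_right minus_diff_eq)
  then have "(norm (v - (2 *\<^sub>R u - s)))\<^sup>2 = (norm (v - u))\<^sup>2 + 2 * ((s - u) \<bullet> (v - u)) + (norm (s - u))\<^sup>2"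
    unfolding eq norm_diff_square[of "v - u" "u - s"] by (simp add: norm_minus_commute[of u s])
  then show ?thesis
    by (simp only: envelope_at_def) (simp add: add_divide_distrib)
qed

lemma DRE_eq_envelope_at:
  fixes \<phi>1 \<phi>2 :: "'a::real_inner \<Rightarrow> ereal"
  assumes no_minf: "\<And>x. \<phi>1 x \<noteq> -\<infinity>" "\<And>x. \<phi>2 x \<noteq> -\<infinity>"
    and prox_unique: "\<And>a b. a \<in> prox \<gamma> \<phi>1 s \<Longrightarrow> b \<in> prox \<gamma> \<phi>1 s \<Longrightarrow> a = b"
    and uv: "(u, v) \<in> DRS \<gamma> \<phi>1 \<phi>2 s"
  shows "DRE \<gamma> \<phi>1 \<phi>2 s = ereal (envelope_at \<gamma> \<phi>1 \<phi>2 s u v)"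
proof -
  obtain u' v' where some: "(SOME p. p \<in> DRS \<gamma> \<phi>1 \<phi>2 s) = (u', v')"
    by fastforce
  then have uv': "(u', v') \<in> DRS \<gamma> \<phi>1 \<phi>2 s"
    using someI[of "\<lambda>p. p \<in> DRS \<gamma> \<phi>1 \<phi>2 s", OF uv] by simp
  have u: "u \<in> prox \<gamma> \<phi>1 s" and v: "v \<in> prox \<gamma> \<phi>2 (2 *\<^sub>R u - s)"
    using uv by (auto simp: DRS_def)
  have u': "u' = u" and v': "v' \<in> prox \<gamma> \<phi>2 (2 *\<^sub>R u - s)"
    using uv uv' prox_unique by (auto simp: DRS_def)
  note finite = prox_finite[OF u no_minf(1)] prox_finite[OF v no_minf(2)] prox_finite[OF v' no_minf(2)]
  have "envelope_at \<gamma> \<phi>1 \<phi>2 s u v' = envelope_at \<gamma> \<phi>1 \<phi>2 s u v"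
    unfolding envelope_at_prox_form
    using prox_le[OF v no_minf(2) finite(3)[symmetric]] prox_le[OF v' no_minf(2) finite(2)[symmetric]]
    by simp
  moreover have "DRE \<gamma> \<phi>1 \<phi>2 s = ereal (envelope_at \<gamma> \<phi>1 \<phi>2 s u v')"
    unfolding DRE_def some Let_def prod.case u' envelope_at_def
    by (subst finite(1)[symmetric], subst finite(3)[symmetric]) simp
  ultimately show ?thesis
    by simp
qed

section \<open>Gain of a relaxed step\<close>

text \<open>
  The algebraic core of both descent estimates, and the origin of the constant \<open>C(\<alpha>, \<lambda>)\<close>. The
  increments \<open>X\<close> and \<open>G\<close> of the proximal point and of the scaled gradient (or the other way round) add
  up to a step of length \<open>\<lambda>\<rho>\<close>, and \<open>G\<close> is at most \<open>\<alpha>\<close> times as long as \<open>X\<close>; \<open>D\<close> is a Bregman distance.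
  The right-hand side is at least \<open>(1 / \<lambda>) ((2 - \<lambda>) / 2 - \<alpha> m) \<parallel>X\<parallel>\<^sup>2\<close>, and the triangle inequality gives
  \<open>\<lambda>\<rho> \<le> (1 + \<alpha>) \<parallel>X\<parallel>\<close>. If \<open>D\<close> only has the lower bound of a nonconvex function, one takes \<open>m = 1\<close>.
  With the cocoercive bound, the coefficient of \<open>\<parallel>G\<parallel>\<^sup>2\<close> on the right is \<open>1 / (2\<alpha>) - 1 / \<lambda>\<close>; its sign, which
  is the sign of \<open>\<lambda> - 2\<alpha>\<close>, decides whether \<open>\<parallel>G\<parallel> \<le> \<alpha> \<parallel>X\<parallel>\<close> or \<open>0 \<le> \<parallel>G\<parallel>\<close> is the worst case.
\<close>

lemma relaxed_step_gain:
  fixes X G :: "'a::real_normed_vector"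
  assumes \<alpha>: "0 \<le> \<alpha>" and lam: "0 < lam" "lam < 2"
    and c: "0 < c" "c < lam / (1 + \<alpha>)\<^sup>2 * ((2 - lam) / 2 - \<alpha> * m)"
    and G: "norm G \<le> \<alpha> * norm X" and r: "norm (X + G) = lam * \<rho>"
    and D: "m = 1 \<and> - \<alpha> / 2 * (norm X)\<^sup>2 \<le> D \<or>
            m = max (\<alpha> - lam / 2) 0 \<and> (norm G)\<^sup>2 / (2 * \<alpha>) \<le> D"
  shows "c * \<rho>\<^sup>2 \<le> D + ((norm X)\<^sup>2 - (norm G)\<^sup>2) / lam - (norm X)\<^sup>2 / 2"
proof -
  \<comment> \<open>Positive, because \<open>0 < c\<close> and \<open>c\<close> is below a positive multiple of it.\<close>
  define \<kappa> where "\<kappa> = (2 - lam) / 2 - \<alpha> * m"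
  define x g where "x = (norm X)\<^sup>2" and "g = (norm G)\<^sup>2"
  have "0 < lam / (1 + \<alpha>)\<^sup>2 * \<kappa>" "0 < lam / (1 + \<alpha>)\<^sup>2"
    using c \<alpha> lam by (auto simp: \<kappa>_def)
  then have \<kappa>: "0 < \<kappa>"
    by (simp only: zero_less_mult_pos)
  have gx: "g \<le> \<alpha>\<^sup>2 * x" and pos: "0 \<le> x" "0 \<le> g"
    using power_mono[OF G, of 2] by (auto simp: g_def x_def power_mult_distrib)
  have "lam * \<rho> \<le> (1 + \<alpha>) * norm X"
    using norm_triangle_ineq[of X G] G r by (simp add: algebra_simps)
  then have "(lam * \<rho>)\<^sup>2 \<le> ((1 + \<alpha>) * norm X)\<^sup>2"
    by (rule power_mono) (metis norm_ge_zero r)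
  then have "\<rho>\<^sup>2 \<le> (1 + \<alpha>)\<^sup>2 * x / lam\<^sup>2"
    using lam by (simp add: x_def power_mult_distrib pos_le_divide_eq mult.commute)
  then have "c * \<rho>\<^sup>2 \<le> (lam / (1 + \<alpha>)\<^sup>2 * \<kappa>) * ((1 + \<alpha>)\<^sup>2 * x / lam\<^sup>2)"
    using c by (intro mult_mono) (auto simp: \<kappa>_def)
  also have "\<dots> = \<kappa> * x / lam"
    using \<alpha> lam by (simp add: power2_eq_square)
  also have "\<dots> \<le> D + (x - g) / lam - x / 2"
  proof -
    \<comment> \<open>The claim multiplied by \<open>2\<lambda>\<close>.\<close>
    have "2 * \<kappa> * x \<le> 2 * lam * D + 2 * (x - g) - lam * x"
      using D
    proof (elim disjE conjE)
      assume m: "m = 1" and "- \<alpha> / 2 * (norm X)\<^sup>2 \<le> D"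
      then have "lam * (- \<alpha> / 2 * x) \<le> lam * D"
        using lam by (intro mult_left_mono) (auto simp: x_def)
      moreover have "0 \<le> (\<alpha> * (2 * \<kappa>)) * x"
        using \<alpha> \<kappa> pos by simp
      ultimately show ?thesis
        using gx by (simp add: \<kappa>_def m power2_eq_square algebra_simps diff_divide_distrib)
    next
      assume m: "m = max (\<alpha> - lam / 2) 0" and "(norm G)\<^sup>2 / (2 * \<alpha>) \<le> D"
      then have D: "lam * (g / (2 * \<alpha>)) \<le> lam * D"
        using lam by (intro mult_left_mono) (auto simp: g_def)
      show ?thesis
      proof (cases "\<alpha> = 0")
        case True
        with gx pos D show ?thesis
          by (simp add: \<kappa>_def field_simps)
      next
        case False
        with \<alpha> have \<alpha>: "0 < \<alpha>"
          by simp
        have D': "lam / \<alpha> * g \<le> 2 * lam * D"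
          using D \<alpha> by (simp add: field_simps)
        show ?thesis
        proof (cases "lam < 2 * \<alpha>")
          case True
          have "(2 - lam / \<alpha>) * g \<le> (2 - lam / \<alpha>) * (\<alpha>\<^sup>2 * x)"
            using True \<alpha> gx by (intro mult_left_mono) (auto simp: field_simps)
          moreover have "lam / \<alpha> * (\<alpha>\<^sup>2 * x) = lam * \<alpha> * x"
            using \<alpha> by (simp add: power2_eq_square)
          ultimately show ?thesis
            using True \<alpha> D' by (simp add: \<kappa>_def m algebra_simps power2_eq_square diff_divide_distrib)
        next
          case False
          then have "0 \<le> (lam / \<alpha> - 2) * g"
            using \<alpha> pos by (intro mult_nonneg_nonneg) (auto simp: field_simps)
          then have "2 * g \<le> lam / \<alpha> * g"
            by (simp add: left_diff_distrib)
          with False D' show ?thesis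
            by (simp add: \<kappa>_def m algebra_simps diff_divide_distrib)
        qed
      qed
    qed
    then show ?thesis
      using lam by (simp add: field_simps)
  qed
  finally show ?thesis
    by (simp add: x_def g_def)
qed

section \<open>Change of the envelope in a nominal step\<close>

lemma envelope_at_le:
  assumes "\<And>x. \<phi>2 x \<noteq> -\<infinity>" "v' \<in> prox \<gamma> \<phi>2 (2 *\<^sub>R u - s)" "\<phi>2 v = ereal b"
  shows "envelope_at \<gamma> \<phi>1 \<phi>2 s u v' \<le> envelope_at \<gamma> \<phi>1 \<phi>2 s u v"
  unfolding envelope_at_prox_form using prox_le[OF assms(2,1,3)] assms(3) by simp

text \<open>
  Replacing \<open>v'\<close> by \<open>v\<close> can only increase the envelope expression at the new point. After that, both values are
  explicit in \<open>f\<close> and its gradient, and \<open>\<gamma>\<close> times their difference is exactly the right-hand side of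
  \<open>relaxed_step_gain\<close>, where \<open>D\<close> is \<open>\<gamma>\<close> times the Bregman distance of \<open>f\<close> from \<open>u'\<close> to \<open>u\<close>.
\<close>

lemma smooth_envelope_decrease:
  fixes f :: "'a::real_inner \<Rightarrow> real"
  assumes deriv: "\<And>x. (f has_derivative (\<lambda>h. G x \<bullet> h)) (at x)"
    and lip: "L-lipschitz_on UNIV G"
    and \<gamma>: "0 < \<gamma>" and lam: "0 < lam" "lam < 2"
    and c: "0 < c" "c < lam / (1 + \<gamma> * L)\<^sup>2 * ((2 - lam) / 2 - \<gamma> * L * m)"
    and m: "m = 1 \<or> m = max (\<gamma> * L - lam / 2) 0 \<and> convex_on UNIV f"
    and no_minf: "\<And>x. \<phi>2 x \<noteq> -\<infinity>"
    and uv: "(u, v) \<in> DRS \<gamma> (\<lambda>x. ereal (f x)) \<phi>2 s"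
    and uv': "(u', v') \<in> DRS \<gamma> (\<lambda>x. ereal (f x)) \<phi>2 (s - lam *\<^sub>R (u - v))"
  shows "envelope_at \<gamma> (\<lambda>x. ereal (f x)) \<phi>2 (s - lam *\<^sub>R (u - v)) u' v'
       \<le> envelope_at \<gamma> (\<lambda>x. ereal (f x)) \<phi>2 s u v - c / \<gamma> * (norm (u - v))\<^sup>2"
proof -
  define s' where "s' = s - lam *\<^sub>R (u - v)"
  define w where "w = v - u"
  define X where "X = u' - u"
  define Y where "Y = \<gamma> *\<^sub>R (G u' - G u)"
  define D where "D = \<gamma> * (f u - f u' - G u' \<bullet> (u - u'))"
  have L: "0 \<le> L"
    using lipschitz_on_nonneg[OF lip] .
  have s: "s = u + \<gamma> *\<^sub>R G u"
    using uv by (intro prox_differentiable_optimality[OF deriv \<gamma>]) (simp add: DRS_def)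
  have s': "s' = u' + \<gamma> *\<^sub>R G u'"
    using uv' by (intro prox_differentiable_optimality[OF deriv \<gamma>]) (simp add: DRS_def s'_def)
  have XY: "X + Y = lam *\<^sub>R w"
  proof -
    have "X + Y = s' - s"
      by (simp add: X_def Y_def s s' algebra_simps)
    then show ?thesis
      by (simp add: s'_def w_def algebra_simps)
  qed
  have Y: "norm Y \<le> \<gamma> * L * norm X"
    using lipschitz_onD[OF lip, of u' u] \<gamma> by (simp add: Y_def X_def dist_norm mult.assoc)
  have "m = 1 \<and> - (\<gamma> * L) / 2 * (norm X)\<^sup>2 \<le> D \<or>
        m = max (\<gamma> * L - lam / 2) 0 \<and> (norm Y)\<^sup>2 / (2 * (\<gamma> * L)) \<le> D"
    using m
  proof (elim disjE conjE)
    assume "m = 1"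
    moreover have "\<gamma> * (- L / 2 * (norm X)\<^sup>2) \<le> D"
      unfolding D_def X_def
      using \<gamma> lipschitz_gradient_lower_bound[OF deriv lip, of u' u]
      by (intro mult_left_mono) (auto simp: norm_minus_commute)
    ultimately show ?thesis
      by simp
  next
    assume "m = max (\<gamma> * L - lam / 2) 0" and conv: "convex_on UNIV f"
    moreover have "\<gamma> * ((norm (G u - G u'))\<^sup>2 / (2 * L)) \<le> D"
      unfolding D_def using \<gamma> convex_gradient_cocoercive[OF deriv lip conv, of u' u]
      by (intro mult_left_mono) auto
    moreover have "\<gamma> * ((norm (G u - G u'))\<^sup>2 / (2 * L)) = (norm Y)\<^sup>2 / (2 * (\<gamma> * L))"
      using \<gamma> by (simp add: Y_def norm_minus_commute power_mult_distrib power2_eq_square)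
    ultimately show ?thesis
      by simp
  qed
  then have "c * (norm w)\<^sup>2 \<le> D + ((norm X)\<^sup>2 - (norm Y)\<^sup>2) / lam - (norm X)\<^sup>2 / 2"
    using \<gamma> L lam c Y XY by (intro relaxed_step_gain[where \<alpha> = "\<gamma> * L" and m = m]) auto
  also have "((norm X)\<^sup>2 - (norm Y)\<^sup>2) / lam = (X - Y) \<bullet> w"
  proof -
    have "(norm X)\<^sup>2 - (norm Y)\<^sup>2 = (X - Y) \<bullet> (X + Y)"
      by (simp add: power2_norm_eq_inner inner_add inner_diff inner_commute)
    then show ?thesis
      using lam by (simp add: XY)
  qed
  also have "D + (X - Y) \<bullet> w - (norm X)\<^sup>2 / 2
      = \<gamma> * (envelope_at \<gamma> (\<lambda>x. ereal (f x)) \<phi>2 s u v - envelope_at \<gamma> (\<lambda>x. ereal (f x)) \<phi>2 s' u' v)"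
  proof -
    have v: "v - u' = w - X"
      by (simp add: w_def X_def)
    have diff: "envelope_at \<gamma> (\<lambda>x. ereal (f x)) \<phi>2 s u v - envelope_at \<gamma> (\<lambda>x. ereal (f x)) \<phi>2 s' u' v
        = f u - f u' + G u \<bullet> w - G u' \<bullet> (w - X) + 1 / (2 * \<gamma>) * ((norm w)\<^sup>2 - (norm (w - X))\<^sup>2)"
      using \<gamma> by (simp add: envelope_at_def s s' v w_def[symmetric] diff_divide_distrib)
    have "(norm w)\<^sup>2 - (norm (w - X))\<^sup>2 = 2 * (X \<bullet> w) - (norm X)\<^sup>2"
      by (simp add: norm_diff_square inner_commute)
    then have half: "\<gamma> * (1 / (2 * \<gamma>) * ((norm w)\<^sup>2 - (norm (w - X))\<^sup>2)) = X \<bullet> w - (norm X)\<^sup>2 / 2"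
      using \<gamma> by (simp add: diff_divide_distrib right_diff_distrib)
    have "D = \<gamma> * (f u - f u' + G u' \<bullet> X)"
      by (simp add: D_def X_def inner_diff_right)
    moreover have "(X - Y) \<bullet> w = X \<bullet> w + \<gamma> * (G u \<bullet> w - G u' \<bullet> w)"
      by (simp add: Y_def inner_diff_left inner_diff_right algebra_simps)
    ultimately show ?thesis
      unfolding diff distrib_left[of \<gamma> _ "_ / _ * _"] half by (simp add: inner_diff_right algebra_simps)
  qed
  finally have "c / \<gamma> * (norm w)\<^sup>2
      \<le> envelope_at \<gamma> (\<lambda>x. ereal (f x)) \<phi>2 s u v - envelope_at \<gamma> (\<lambda>x. ereal (f x)) \<phi>2 s' u' v"
    using \<gamma> by (simp add: divide_le_eq mult.commute)
  moreover have "envelope_at \<gamma> (\<lambda>x. ereal (f x)) \<phi>2 s' u' v' \<le> envelope_at \<gamma> (\<lambda>x. ereal (f x)) \<phi>2 s' u' v"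
  proof (rule envelope_at_le[OF no_minf])
    show "v' \<in> prox \<gamma> \<phi>2 (2 *\<^sub>R u' - s')"
      using uv' by (simp add: DRS_def s'_def)
    show "\<phi>2 v = ereal (real_of_ereal (\<phi>2 v))"
      using uv prox_finite[of v \<gamma> \<phi>2, OF _ no_minf] by (auto simp: DRS_def)
  qed
  ultimately show ?thesis
    by (simp add: s'_def w_def norm_minus_commute)
qed

text \<open>
  The sum of the subgradient inequality of \<open>\<phi>1\<close> at \<open>u\<close>, tested at \<open>x\<close>, and that of \<open>\<phi>2\<close> at \<open>v\<close>, tested at
  \<open>y\<close>. For \<open>x = y\<close> it bounds the envelope by the cost; for \<open>x \<noteq> y\<close> it bounds the inner product of
  \<open>s - u\<close> with \<open>x - y\<close>.
\<close>

lemma strongly_convex_two_point_bound: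
  fixes \<phi>1 \<phi>2 :: "'a::real_inner \<Rightarrow> ereal"
  assumes no_minf: "\<And>x. \<phi>1 x \<noteq> -\<infinity>" "\<And>x. \<phi>2 x \<noteq> -\<infinity>"
    and conv: "convex_fun (\<lambda>x. \<phi>1 x - ereal (\<mu> / 2 * (norm x)\<^sup>2))" "convex_fun \<phi>2"
    and \<gamma>: "0 < \<gamma>" and uv: "(u, v) \<in> DRS \<gamma> \<phi>1 \<phi>2 s"
    and ab: "\<phi>1 x = ereal a" "\<phi>2 y = ereal b"
  shows "envelope_at \<gamma> \<phi>1 \<phi>2 s u v + \<mu> / 2 * (norm (x - u))\<^sup>2 + (s - u) \<bullet> (x - y) / \<gamma>
      + (u - v) \<bullet> (y - v) / \<gamma> - (norm (u - v))\<^sup>2 / (2 * \<gamma>) \<le> a + b"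
proof -
  have u: "u \<in> prox \<gamma> \<phi>1 s" and v: "v \<in> prox \<gamma> \<phi>2 (2 *\<^sub>R u - s)"
    using uv by (auto simp: DRS_def)
  have "real_of_ereal (\<phi>1 u) + (s - u) \<bullet> (x - u) / \<gamma> + \<mu> / 2 * (norm (x - u))\<^sup>2 \<le> a"
    by (rule prox_subgradient[OF no_minf(1) conv(1) \<gamma> u ab(1)])
  moreover have "real_of_ereal (\<phi>2 v) + (2 *\<^sub>R u - s - v) \<bullet> (y - v) / \<gamma> \<le> b"
    using prox_subgradient[OF no_minf(2) _ \<gamma> v ab(2), of 0] conv(2) by (simp add: zero_ereal_def[symmetric])
  moreover have "(2 *\<^sub>R u - s - v) \<bullet> (y - v) = (u - v) \<bullet> (y - v) - (s - u) \<bullet> (y - v)"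
  proof -
    have "2 *\<^sub>R u - s - v = (u - v) - (s - u)"
      by (simp add: scaleR_2)
    then show ?thesis
      by (simp only: inner_diff_left)
  qed
  moreover have "(s - u) \<bullet> (x - u) - (s - u) \<bullet> (y - v) = (s - u) \<bullet> (x - y) + (s - u) \<bullet> (v - u)"
    by (simp add: inner_diff_right)
  then have "(s - u) \<bullet> (x - u) / \<gamma> - (s - u) \<bullet> (y - v) / \<gamma> = (s - u) \<bullet> (x - y) / \<gamma> + (s - u) \<bullet> (v - u) / \<gamma>"
    by (simp add: add_divide_distrib[symmetric] diff_divide_distrib[symmetric])
  ultimately show ?thesis
    by (simp add: envelope_at_def norm_minus_commute[of v u] diff_divide_distrib)
qed

text \<open>
  The case \<open>x = y\<close> of the preceding bound. If \<open>1 / \<gamma> < \<mu>\<close>, the envelope is a lower bound of the cost, and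
  the gap to the cost at \<open>x\<close> controls the distance of \<open>u\<close> from \<open>x\<close>.
\<close>

lemma strongly_convex_envelope_gap:
  fixes \<phi>1 \<phi>2 :: "'a::real_inner \<Rightarrow> ereal"
  assumes no_minf: "\<And>x. \<phi>1 x \<noteq> -\<infinity>" "\<And>x. \<phi>2 x \<noteq> -\<infinity>"
    and conv: "convex_fun (\<lambda>x. \<phi>1 x - ereal (\<mu> / 2 * (norm x)\<^sup>2))" "convex_fun \<phi>2"
    and \<gamma>: "0 < \<gamma>" and uv: "(u, v) \<in> DRS \<gamma> \<phi>1 \<phi>2 s"
    and ab: "\<phi>1 x = ereal a" "\<phi>2 x = ereal b"
  shows "envelope_at \<gamma> \<phi>1 \<phi>2 s u v + (\<mu> - 1 / \<gamma>) / 2 * (norm (x - u))\<^sup>2 \<le> a + b"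
proof -
  have eq: "x - u = (x - v) - (u - v)"
    by simp
  have "(norm (x - u))\<^sup>2 = (norm (x - v))\<^sup>2 - 2 * ((u - v) \<bullet> (x - v)) + (norm (u - v))\<^sup>2"
    unfolding eq norm_diff_square[of "x - v" "u - v"] by (simp add: inner_commute)
  then have "(norm (x - u))\<^sup>2 / (2 * \<gamma>)
      = (norm (x - v))\<^sup>2 / (2 * \<gamma>) - (u - v) \<bullet> (x - v) / \<gamma> + (norm (u - v))\<^sup>2 / (2 * \<gamma>)"
    by (simp add: add_divide_distrib diff_divide_distrib)
  moreover have "0 \<le> (norm (x - v))\<^sup>2 / (2 * \<gamma>)"
    using \<gamma> by simp
  moreover have "(\<mu> - 1 / \<gamma>) / 2 * (norm (x - u))\<^sup>2 = \<mu> / 2 * (norm (x - u))\<^sup>2 - (norm (x - u))\<^sup>2 / (2 * \<gamma>)"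
    by (simp add: left_diff_distrib diff_divide_distrib)
  moreover have "envelope_at \<gamma> \<phi>1 \<phi>2 s u v + \<mu> / 2 * (norm (x - u))\<^sup>2
      + (u - v) \<bullet> (x - v) / \<gamma> - (norm (u - v))\<^sup>2 / (2 * \<gamma>) \<le> a + b"
    using strongly_convex_two_point_bound[OF no_minf conv \<gamma> uv ab] by simp
  ultimately show ?thesis
    by linarith
qed

lemma prox_strongly_convex_strongly_monotone:
  fixes h :: "'a::real_inner \<Rightarrow> ereal"
  assumes no_minf: "\<And>x. h x \<noteq> -\<infinity>"
    and conv: "convex_fun (\<lambda>x. h x - ereal (\<mu> / 2 * (norm x)\<^sup>2))"
    and \<gamma>: "0 < \<gamma>" and u: "u \<in> prox \<gamma> h s" and u': "u' \<in> prox \<gamma> h s'"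
  shows "\<gamma> * \<mu> * (norm (u' - u))\<^sup>2 \<le> ((s' - u') - (s - u)) \<bullet> (u' - u)"
proof -
  note finite = prox_finite[OF u no_minf, symmetric] prox_finite[OF u' no_minf, symmetric]
  have "real_of_ereal (h u) + (s - u) \<bullet> (u' - u) / \<gamma> + \<mu> / 2 * (norm (u' - u))\<^sup>2 \<le> real_of_ereal (h u')"
    by (rule prox_subgradient[OF no_minf conv \<gamma> u finite(2)])
  moreover have "real_of_ereal (h u') + (s' - u') \<bullet> (u - u') / \<gamma> + \<mu> / 2 * (norm (u' - u))\<^sup>2 \<le> real_of_ereal (h u)"
    using prox_subgradient[OF no_minf conv \<gamma> u' finite(1)] by (simp add: norm_minus_commute)
  moreover have "(s' - u') \<bullet> (u - u') / \<gamma> = - ((s' - u') \<bullet> (u' - u) / \<gamma>)"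
    by (metis inner_minus_right minus_diff_eq minus_divide_left)
  ultimately have "\<mu> * (norm (u' - u))\<^sup>2 \<le> ((s' - u') \<bullet> (u' - u) - (s - u) \<bullet> (u' - u)) / \<gamma>"
    by (simp add: diff_divide_distrib)
  then show ?thesis
    using \<gamma> by (simp add: inner_diff_left le_divide_eq mult_ac)
qed

lemma strongly_convex_prox_unique:
  fixes h :: "'a::real_inner \<Rightarrow> ereal"
  assumes no_minf: "\<And>x. h x \<noteq> -\<infinity>"
    and conv: "convex_fun (\<lambda>x. h x - ereal (\<mu> / 2 * (norm x)\<^sup>2))" and \<mu>: "0 < \<mu>"
    and \<gamma>: "0 < \<gamma>" and u: "u \<in> prox \<gamma> h s" and u': "u' \<in> prox \<gamma> h s"
  shows "u = u'"
proof -
  have "((s - u') - (s - u)) \<bullet> (u' - u) = - (norm (u' - u))\<^sup>2"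
    by (simp add: power2_norm_eq_inner inner_diff)
  then have "(\<gamma> * \<mu> + 1) * (norm (u' - u))\<^sup>2 \<le> 0"
    using prox_strongly_convex_strongly_monotone[OF no_minf conv \<gamma> u u'] by (simp add: algebra_simps)
  moreover have "0 < \<gamma> * \<mu> + 1"
    using \<gamma> \<mu> by (simp add: add_pos_pos)
  ultimately have "(norm (u' - u))\<^sup>2 \<le> 0"
    by (simp add: mult_le_0_iff)
  then show ?thesis
    by simp
qed

text \<open>
  By duality this is the smooth estimate for \<open>\<phi>1\<^sup>*\<close>, whose gradient is Lipschitz with constant \<open>1 / \<mu>\<close>, with
  stepsize \<open>1 / \<gamma>\<close>. Carried out on the primal side, it exchanges the roles of the two increments:
  \<open>u' - u\<close> is now at most \<open>\<alpha>\<close> times as long as the increment of \<open>s - u\<close>. The subgradient inequality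
  of \<open>\<phi>2\<close> at \<open>v\<close> takes the place of the optimality of \<open>v'\<close>.
\<close>

lemma strongly_convex_envelope_increase:
  fixes \<phi>1 \<phi>2 :: "'a::real_inner \<Rightarrow> ereal"
  assumes no_minf: "\<And>x. \<phi>1 x \<noteq> -\<infinity>" "\<And>x. \<phi>2 x \<noteq> -\<infinity>"
    and conv: "convex_fun (\<lambda>x. \<phi>1 x - ereal (\<mu> / 2 * (norm x)\<^sup>2))" "convex_fun \<phi>2"
    and \<mu>: "0 < \<mu>" and \<gamma>: "0 < \<gamma>" and lam: "0 < lam" "lam < 2"
    and \<alpha>: "\<alpha> = 1 / (\<gamma> * \<mu>)"
    and c: "0 < c" "c < lam / (1 + \<alpha>)\<^sup>2 * ((2 - lam) / 2 - \<alpha> * max (\<alpha> - lam / 2) 0)"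
    and uv: "(u, v) \<in> DRS \<gamma> \<phi>1 \<phi>2 s"
    and uv': "(u', v') \<in> DRS \<gamma> \<phi>1 \<phi>2 (s - lam *\<^sub>R (u - v))"
  shows "envelope_at \<gamma> \<phi>1 \<phi>2 s u v + c / \<gamma> * (norm (u - v))\<^sup>2
       \<le> envelope_at \<gamma> \<phi>1 \<phi>2 (s - lam *\<^sub>R (u - v)) u' v'"
proof -
  define s' where "s' = s - lam *\<^sub>R (u - v)"
  define w where "w = v - u"
  define w' where "w' = v' - u'"
  define p where "p = s - u"
  define X where "X = u' - u"
  define Y where "Y = (s' - u') - (s - u)"
  have u: "u \<in> prox \<gamma> \<phi>1 s" and v: "v \<in> prox \<gamma> \<phi>2 (2 *\<^sub>R u - s)"
    using uv by (auto simp: DRS_def)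
  have u': "u' \<in> prox \<gamma> \<phi>1 s'" and v': "v' \<in> prox \<gamma> \<phi>2 (2 *\<^sub>R u' - s')"
    using uv' by (auto simp: DRS_def s'_def)
  define a b a' b' where "a = real_of_ereal (\<phi>1 u)" and "b = real_of_ereal (\<phi>2 v)"
    and "a' = real_of_ereal (\<phi>1 u')" and "b' = real_of_ereal (\<phi>2 v')"
  have a': "\<phi>1 u' = ereal a'" and b': "\<phi>2 v' = ereal b'"
    using prox_finite[OF u' no_minf(1)] prox_finite[OF v' no_minf(2)] by (simp_all add: a'_def b'_def)
  define D where "D = \<gamma> * (a' - a) - p \<bullet> X"
  have XY: "Y + X = lam *\<^sub>R w"
    by (simp add: X_def Y_def s'_def w_def algebra_simps)
  have \<alpha>': "0 < \<alpha>" "\<gamma> * \<mu> = 1 / \<alpha>"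
    using \<alpha> \<gamma> \<mu> by auto
  have X: "norm X \<le> \<alpha> * norm Y"
  proof (cases "X = 0")
    case True
    then show ?thesis
      using \<alpha>' by simp
  next
    case False
    have "\<gamma> * \<mu> * (norm X)\<^sup>2 \<le> Y \<bullet> X"
      unfolding X_def Y_def by (rule prox_strongly_convex_strongly_monotone[OF no_minf(1) conv(1) \<gamma> u u'])
    also have "\<dots> \<le> norm Y * norm X"
      by (rule norm_cauchy_schwarz)
    finally have "(norm X / \<alpha>) * norm X \<le> norm Y * norm X"
      using \<alpha>' by (simp add: power2_eq_square)
    then show ?thesis
      using False \<alpha>' by (simp add: divide_le_eq mult.commute)
  qed
  have "(norm X)\<^sup>2 / (2 * \<alpha>) \<le> D"
  proof -
    have "a + p \<bullet> X / \<gamma> + \<mu> / 2 * (norm X)\<^sup>2 \<le> a'"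
      unfolding a_def p_def X_def by (rule prox_subgradient[OF no_minf(1) conv(1) \<gamma> u a'])
    then have "\<gamma> * (\<mu> / 2 * (norm X)\<^sup>2) \<le> \<gamma> * (a' - a - p \<bullet> X / \<gamma>)"
      using \<gamma> by (intro mult_left_mono) auto
    then show ?thesis
      using \<gamma> \<mu> by (simp add: D_def \<alpha> algebra_simps)
  qed
  then have "c * (norm w)\<^sup>2 \<le> D + ((norm Y)\<^sup>2 - (norm X)\<^sup>2) / lam - (norm Y)\<^sup>2 / 2"
    using lam c X XY \<alpha>'(1) by (intro relaxed_step_gain[where \<alpha> = \<alpha>]) auto
  also have "((norm Y)\<^sup>2 - (norm X)\<^sup>2) / lam = (Y - X) \<bullet> w"
  proof -
    have "(norm Y)\<^sup>2 - (norm X)\<^sup>2 = (Y - X) \<bullet> (Y + X)"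
      by (simp add: power2_norm_eq_inner inner_add inner_diff inner_commute)
    then show ?thesis
      using lam by (simp add: XY)
  qed
  also have "D + (Y - X) \<bullet> w - (norm Y)\<^sup>2 / 2
      \<le> \<gamma> * (envelope_at \<gamma> \<phi>1 \<phi>2 s' u' v' - envelope_at \<gamma> \<phi>1 \<phi>2 s u v)"
  proof -
    have "b + (2 *\<^sub>R u - s - v) \<bullet> (v' - v) / \<gamma> \<le> b'"
      using prox_subgradient[OF no_minf(2) _ \<gamma> v b', of 0] conv(2)
      by (simp add: zero_ereal_def[symmetric] b_def)
    moreover have "2 *\<^sub>R u - s - v = - (p + w)" "v' - v = w' - w + X"
      by (simp_all add: p_def w_def w'_def X_def scaleR_2)
    then have "(2 *\<^sub>R u - s - v) \<bullet> (v' - v) = - ((p + w) \<bullet> (w' - w + X))"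
      by (simp only: inner_minus_left)
    ultimately have "- ((p + w) \<bullet> (w' - w + X)) / \<gamma> \<le> b' - b"
      by simp
    then have "\<gamma> * (- ((p + w) \<bullet> (w' - w + X)) / \<gamma>) \<le> \<gamma> * (b' - b)"
      using \<gamma> by (intro mult_left_mono) auto
    then have b: "- ((p + w) \<bullet> (w' - w + X)) \<le> \<gamma> * (b' - b)"
      using \<gamma> by simp
    have "s' - u' = p + Y"
      by (simp add: p_def Y_def)
    then have "\<gamma> * (envelope_at \<gamma> \<phi>1 \<phi>2 s' u' v' - envelope_at \<gamma> \<phi>1 \<phi>2 s u v)
      = \<gamma> * (a' - a) + \<gamma> * (b' - b) + ((p + Y) \<bullet> w' + (norm w')\<^sup>2 / 2) - (p \<bullet> w + (norm w)\<^sup>2 / 2)"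
      unfolding envelope_at_def using \<gamma>
      by (simp add: a_def b_def a'_def b'_def w_def[symmetric] w'_def[symmetric] p_def[symmetric]
          algebra_simps)
    \<comment> \<open>The terms with \<open>v'\<close> combine to this square, which vanishes at the minimizer in \<open>v'\<close>.\<close>
    moreover have "0 \<le> (norm (w' - w + Y))\<^sup>2 / 2"
      by simp
    moreover have "(norm (w' - w + Y))\<^sup>2 / 2 = (norm w')\<^sup>2 / 2 + (norm w)\<^sup>2 / 2 + (norm Y)\<^sup>2 / 2
        - w \<bullet> w' + Y \<bullet> w' - Y \<bullet> w"
      by (simp add: power2_norm_eq_inner inner_add inner_diff inner_commute field_simps)
    moreover have "(p + w) \<bullet> (w' - w + X) = p \<bullet> w' - p \<bullet> w + p \<bullet> X + w \<bullet> w' - (norm w)\<^sup>2 + X \<bullet> w"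
      by (simp add: power2_norm_eq_inner inner_add inner_diff inner_commute)
    ultimately show ?thesis
      using b by (simp add: D_def inner_add_left inner_diff_left)
  qed
  finally have "c / \<gamma> * (norm w)\<^sup>2
      \<le> envelope_at \<gamma> \<phi>1 \<phi>2 s' u' v' - envelope_at \<gamma> \<phi>1 \<phi>2 s u v"
    using \<gamma> by (simp add: divide_le_eq mult.commute)
  then show ?thesis
    by (simp add: s'_def w_def norm_minus_commute)
qed

section \<open>The linesearch\<close>

lemma linesearch_DRS_in_DRS:
  assumes "linesearch_DRS \<pi> \<gamma> lam c \<epsilon> imax \<phi>1 \<phi>2 s u v"
  shows "(u k, v k) \<in> DRS \<gamma> \<phi>1 \<phi>2 (s k)"
proof (induction k)
  case 0
  then show ?case
    using assms by (simp add: linesearch_DRS_def)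
next
  case (Suc k)
  then show ?case
    using assms unfolding linesearch_DRS_def Let_def by (metis (no_types, lifting))
qed

text \<open>
  An accepted trial point satisfies the decrease by definition of the test, and the only other point that
  the linesearch can return is the nominal one.
\<close>

lemma linesearch_DRS_merit_step:
  assumes iter: "linesearch_DRS \<pi> \<gamma> lam c 0 imax \<phi>1 \<phi>2 s u v" and \<gamma>: "0 < \<gamma>"
    and DRE: "\<And>s u v. (u, v) \<in> DRS \<gamma> \<phi>1 \<phi>2 s \<Longrightarrow> DRE \<gamma> \<phi>1 \<phi>2 s = ereal (envelope_at \<gamma> \<phi>1 \<phi>2 s u v)"
    and nominal: "\<And>s u v u' v'. (u, v) \<in> DRS \<gamma> \<phi>1 \<phi>2 s \<Longrightarrow>
      (u', v') \<in> DRS \<gamma> \<phi>1 \<phi>2 (s - lam *\<^sub>R (u - v)) \<Longrightarrow>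
      \<pi> * envelope_at \<gamma> \<phi>1 \<phi>2 (s - lam *\<^sub>R (u - v)) u' v'
        \<le> \<pi> * envelope_at \<gamma> \<phi>1 \<phi>2 s u v - c / \<gamma> * (norm (u - v))\<^sup>2"
  shows "\<pi> * envelope_at \<gamma> \<phi>1 \<phi>2 (s (Suc k)) (u (Suc k)) (v (Suc k))
       \<le> \<pi> * envelope_at \<gamma> \<phi>1 \<phi>2 (s k) (u k) (v k) - c / \<gamma> * (norm (u k - v k))\<^sup>2"
proof (cases "u k = v k")
  case True
  then have "s (Suc k) = s k \<and> u (Suc k) = u k \<and> v (Suc k) = v k"
    using iter[unfolded linesearch_DRS_def Let_def, THEN conjunct2, rule_format, of k] by simp
  with True show ?thesis
    by simp
next
  case False
  then have "\<not> 1 / \<gamma> * norm (u k - v k) \<le> 0"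
    using \<gamma> by (simp add: divide_le_0_iff)
  then obtain d where "linesearch_next \<pi> \<gamma> c imax \<phi>1 \<phi>2 (s k) (u k - v k) (s k - lam *\<^sub>R (u k - v k)) d (s (Suc k))"
    using iter[unfolded linesearch_DRS_def Let_def, THEN conjunct2, rule_format, of k] by auto
  then consider "sufficient_progress \<pi> \<gamma> c \<phi>1 \<phi>2 (s k) (u k - v k) (s (Suc k))"
    | "s (Suc k) = s k - lam *\<^sub>R (u k - v k)"
    unfolding linesearch_next_def by (metis (no_types, lifting))
  then show ?thesis
  proof cases
    case 1
    then show ?thesis
      using DRE[OF linesearch_DRS_in_DRS[OF iter]] by (simp add: sufficient_progress_def)
  next
    case 2
    then show ?thesis
      using nominal[OF linesearch_DRS_in_DRS[OF iter, of k], of "u (Suc k)" "v (Suc k)"]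
        linesearch_DRS_in_DRS[OF iter, of "Suc k"] by simp
  qed
qed

lemma decreasing_merit_convergence:
  fixes E a :: "nat \<Rightarrow> real"
  assumes step: "\<And>k. E (Suc k) \<le> E k - a k" and nonneg: "\<And>k. 0 \<le> a k"
    and lower: "\<And>k. m \<le> E k"
  shows "summable a" "decseq E" "convergent E"
proof -
  have "(\<Sum>k<n. a k) \<le> E 0 - E n" for n
  proof (induction n)
    case (Suc n)
    then show ?case
      using step[of n] by simp
  qed simp
  then have "(\<Sum>k<n. a k) \<le> E 0 - m" for n
    using lower[of n] by (smt (verit))
  then show "summable a"
    by (rule summableI_nonneg_bounded[OF nonneg])
  show "decseq E"
    using step nonneg by (intro decseq_SucI) (smt (verit))
  then show "convergent E"
    using decseq_convergent[of E m] lower unfolding convergent_def by metis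
qed

section \<open>Differences of domains\<close>

text \<open>
  A pointwise upper bound on a small ball of \<open>S\<close>, used at the multiples \<open>\<plusminus>(e / 2) b\<close> of the finitely many
  elements of an orthonormal basis, gives a uniform two-sided bound.
\<close>

lemma bounded_above_near_zero_imp_bounded:
  fixes Y :: "'a::euclidean_space set"
  assumes S: "subspace S" and e: "0 < e"
    and above: "\<And>w. w \<in> S \<Longrightarrow> norm w < e \<Longrightarrow> \<exists>B. \<forall>y\<in>Y. y \<bullet> w \<le> B"
  obtains B where "\<And>y w. y \<in> Y \<Longrightarrow> w \<in> S \<Longrightarrow> \<bar>y \<bullet> w\<bar> \<le> B * norm w"
proof -
  obtain A where A: "A \<subseteq> S" "pairwise orthogonal A" "\<And>x. x \<in> A \<Longrightarrow> norm x = 1"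
    "independent A" "span A = S"
    using orthonormal_basis_subspace[OF S] by metis
  have "finite A"
    using A(4) by (rule independent_imp_finite)
  have "\<exists>M. \<forall>y\<in>Y. \<bar>y \<bullet> b\<bar> \<le> M" if "b \<in> A" for b
  proof -
    have b: "b \<in> S" "norm b = 1"
      using A that by auto
    obtain B1 where B1: "\<forall>y\<in>Y. y \<bullet> ((e / 2) *\<^sub>R b) \<le> B1"
      using above[of "(e / 2) *\<^sub>R b"] b e S by (auto simp: subspace_scale)
    obtain B2 where B2: "\<forall>y\<in>Y. y \<bullet> ((- e / 2) *\<^sub>R b) \<le> B2"
      using above[of "(- e / 2) *\<^sub>R b"] b e S by (auto simp: subspace_scale subspace_neg)
    have "\<bar>y \<bullet> b\<bar> \<le> 2 / e * max B1 B2" if "y \<in> Y" for y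
    proof -
      have "\<bar>e / 2 * (y \<bullet> b)\<bar> \<le> max B1 B2"
        using B1[rule_format, OF that] B2[rule_format, OF that]
          max.cobounded1[of B1 B2] max.cobounded2[of B2 B1] by (auto simp: abs_le_iff)
      then show ?thesis
        using e by (simp add: abs_mult field_simps)
    qed
    then show ?thesis
      by blast
  qed
  then obtain M where M: "\<And>b y. b \<in> A \<Longrightarrow> y \<in> Y \<Longrightarrow> \<bar>y \<bullet> b\<bar> \<le> M b"
    by metis
  have "\<bar>y \<bullet> w\<bar> \<le> (\<Sum>b\<in>A. M b) * norm w" if "y \<in> Y" "w \<in> S" for y w
  proof -
    have "w \<in> span A"
      using that A by simp
    then have "y \<bullet> w = y \<bullet> (\<Sum>b\<in>A. (w \<bullet> b) *\<^sub>R b)"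
      using orthonormal_basis_expand[OF A(2,3) _ \<open>finite A\<close>] by simp
    also have "\<dots> = (\<Sum>b\<in>A. (w \<bullet> b) * (y \<bullet> b))"
      by (simp add: inner_sum_right)
    finally have "\<bar>y \<bullet> w\<bar> \<le> (\<Sum>b\<in>A. \<bar>(w \<bullet> b) * (y \<bullet> b)\<bar>)"
      by (simp add: sum_abs)
    also have "\<dots> \<le> (\<Sum>b\<in>A. norm w * M b)"
    proof (rule sum_mono)
      fix b assume "b \<in> A"
      then have "\<bar>w \<bullet> b\<bar> \<le> norm w" "\<bar>y \<bullet> b\<bar> \<le> M b"
        using Cauchy_Schwarz_ineq2[of w b] A(3) M that by auto
      then show "\<bar>(w \<bullet> b) * (y \<bullet> b)\<bar> \<le> norm w * M b"
        unfolding abs_mult by (intro mult_mono) auto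
    qed
    finally show ?thesis
      by (simp add: sum_distrib_left mult.commute)
  qed
  then show thesis
    using that by blast
qed

lemma zero_rel_interior_imp_ball_in_span:
  fixes D :: "'a::euclidean_space set"
  assumes "0 \<in> rel_interior D"
  obtains e where "0 < e" "\<And>w. w \<in> span D \<Longrightarrow> norm w < e \<Longrightarrow> w \<in> D"
proof -
  obtain e where "0 \<in> D" and e: "0 < e" "ball 0 e \<inter> affine hull D \<subseteq> D"
    using assms by (auto simp: mem_rel_interior_ball)
  then have "affine hull D = span D"
    by (intro affine_hull_span_0) (simp add: hull_inc)
  then have "w \<in> D" if "w \<in> span D" "norm w < e" for w
    using e that by auto
  with e(1) show thesis
    using that by blast
qed

lemma eff_dom_eq_ereal:
  assumes "x \<in> eff_dom h" "h x \<noteq> -\<infinity>"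
  obtains a where "h x = ereal a"
  using assms by (cases "h x") (auto simp: eff_dom_def)

lemma set_diffI: "a \<in> A \<Longrightarrow> b \<in> B \<Longrightarrow> a - b \<in> set_diff A B"
  by (auto simp: set_diff_def)

lemma set_diff_eff_domE:
  assumes "w \<in> set_diff (eff_dom h1) (eff_dom h2)"
    and "\<And>x. h1 x \<noteq> -\<infinity>" "\<And>x. h2 x \<noteq> -\<infinity>"
  obtains x y a b where "w = x - y" "h1 x = ereal a" "h2 y = ereal b"
proof -
  obtain x y where xy: "w = x - y" "x \<in> eff_dom h1" "y \<in> eff_dom h2"
    using assms(1) by (auto simp: set_diff_def)
  obtain a where "h1 x = ereal a"
    using eff_dom_eq_ereal[OF xy(2) assms(2)] .
  moreover obtain b where "h2 y = ereal b"
    using eff_dom_eq_ereal[OF xy(3) assms(3)] .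
  ultimately show thesis
    using that xy(1) by blast
qed

lemma DRS_eff_dom:
  assumes "\<And>x. h1 x \<noteq> -\<infinity>" "\<And>x. h2 x \<noteq> -\<infinity>" and "(u, v) \<in> DRS \<gamma> h1 h2 s"
  shows "u \<in> eff_dom h1" "v \<in> eff_dom h2"
proof -
  have u: "u \<in> prox \<gamma> h1 s" and v: "v \<in> prox \<gamma> h2 (2 *\<^sub>R u - s)"
    using assms(3) by (auto simp: DRS_def)
  show "u \<in> eff_dom h1"
    using prox_finite[OF u assms(1)] by (cases "h1 u") (auto simp: eff_dom_def)
  show "v \<in> eff_dom h2"
    using prox_finite[OF v assms(2)] by (cases "h2 v") (auto simp: eff_dom_def)
qed

section \<open>Convergence in the strongly convex case\<close>

text \<open>
  The vectors \<open>(s - u) / \<gamma>\<close> are subgradients of \<open>\<phi>1\<close> at the points \<open>u\<close> and may be unbounded. Every small \<open>w\<close> in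
  the span of \<open>dom \<phi>1 - dom \<phi>2\<close> is however of the form \<open>x - y\<close> with \<open>x\<close> and \<open>y\<close> in the two domains, and the
  two-point bound at such a pair limits their inner product with \<open>w\<close> from above.
\<close>

lemma strongly_convex_splitting_dual_bounded:
  fixes \<phi>1 \<phi>2 :: "'a::euclidean_space \<Rightarrow> ereal"
  assumes no_minf: "\<And>x. \<phi>1 x \<noteq> -\<infinity>" "\<And>x. \<phi>2 x \<noteq> -\<infinity>"
    and conv: "convex_fun (\<lambda>x. \<phi>1 x - ereal (\<mu> / 2 * (norm x)\<^sup>2))" "convex_fun \<phi>2"
    and \<mu>: "0 < \<mu>" and \<gamma>: "0 < \<gamma>"
    and rel: "0 \<in> rel_interior (set_diff (eff_dom \<phi>1) (eff_dom \<phi>2))"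
    and DRS: "\<And>k. (u k, v k) \<in> DRS \<gamma> \<phi>1 \<phi>2 (s k)"
    and lower: "\<And>k. E0 \<le> envelope_at \<gamma> \<phi>1 \<phi>2 (s k) (u k) (v k)"
    and bounded: "bounded (range u)" "bounded (range v)"
  obtains B where "\<And>k w. w \<in> span (set_diff (eff_dom \<phi>1) (eff_dom \<phi>2)) \<Longrightarrow>
    \<bar>(s k - u k) \<bullet> w\<bar> \<le> B * norm w"
proof -
  define D where "D = set_diff (eff_dom \<phi>1) (eff_dom \<phi>2)"
  obtain e where e: "0 < e" "\<And>w. w \<in> span D \<Longrightarrow> norm w < e \<Longrightarrow> w \<in> D"
    using zero_rel_interior_imp_ball_in_span[OF rel] unfolding D_def by blast
  obtain U V where UV: "\<And>k. norm (u k) \<le> U" "\<And>k. norm (v k) \<le> V"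
    using bounded by (auto simp: bounded_iff)
  have "\<exists>B. \<forall>p\<in>range (\<lambda>k. s k - u k). p \<bullet> w \<le> B" if small: "w \<in> span D" "norm w < e" for w
  proof -
    obtain x y a b where w: "w = x - y" and ab: "\<phi>1 x = ereal a" "\<phi>2 y = ereal b"
      using set_diff_eff_domE[OF e(2)[OF small, unfolded D_def] no_minf] .
    have "(s k - u k) \<bullet> w \<le> \<gamma> * (a + b - E0) + (U + V) * (norm y + V) + (U + V)\<^sup>2" for k
    proof -
      have r: "norm (u k - v k) \<le> U + V" and "norm (y - v k) \<le> norm y + V"
        using UV[of k] norm_triangle_ineq4[of "u k" "v k"] norm_triangle_ineq4[of y "v k"] by auto
      then have "norm (u k - v k) * norm (y - v k) \<le> (U + V) * (norm y + V)"
        by (intro mult_mono) (auto intro: order_trans[OF norm_ge_zero])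
      then have "- ((u k - v k) \<bullet> (y - v k)) \<le> (U + V) * (norm y + V)"
        using Cauchy_Schwarz_ineq2[of "u k - v k" "y - v k"] by linarith
      moreover have "(norm (u k - v k))\<^sup>2 \<le> (U + V)\<^sup>2"
        using r by (intro power_mono) auto
      moreover have "\<gamma> * (E0 + (s k - u k) \<bullet> w / \<gamma> + (u k - v k) \<bullet> (y - v k) / \<gamma>
          - (norm (u k - v k))\<^sup>2 / (2 * \<gamma>)) \<le> \<gamma> * (a + b)"
      proof (rule mult_left_mono)
        have "0 \<le> \<mu> / 2 * (norm (x - u k))\<^sup>2"
          using \<mu> by simp
        then show "E0 + (s k - u k) \<bullet> w / \<gamma> + (u k - v k) \<bullet> (y - v k) / \<gamma>
            - (norm (u k - v k))\<^sup>2 / (2 * \<gamma>) \<le> a + b"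
          using strongly_convex_two_point_bound[OF no_minf conv \<gamma> DRS[of k] ab] lower[of k]
          unfolding w by linarith
      qed (use \<gamma> in simp)
      then have "\<gamma> * E0 + (s k - u k) \<bullet> w + (u k - v k) \<bullet> (y - v k) - (norm (u k - v k))\<^sup>2 / 2 \<le> \<gamma> * (a + b)"
        using \<gamma> by (simp add: distrib_left right_diff_distrib)
      moreover have "\<gamma> * (a + b - E0) = \<gamma> * (a + b) - \<gamma> * E0"
        by (simp add: right_diff_distrib)
      moreover have "0 \<le> (norm (u k - v k))\<^sup>2"
        by simp
      ultimately show ?thesis
        by linarith
    qed
    then show ?thesis
      by blast
  qed
  then obtain B where "\<And>p w. p \<in> range (\<lambda>k. s k - u k) \<Longrightarrow> w \<in> span D \<Longrightarrow> \<bar>p \<bullet> w\<bar> \<le> B * norm w"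
    using bounded_above_near_zero_imp_bounded[OF subspace_span e(1)] by blast
  then show thesis
    using that unfolding D_def by blast
qed

lemma strongly_convex_splitting_primal_bounded:
  fixes \<phi>1 \<phi>2 :: "'a::euclidean_space \<Rightarrow> ereal"
  assumes no_minf: "\<And>x. \<phi>1 x \<noteq> -\<infinity>" "\<And>x. \<phi>2 x \<noteq> -\<infinity>"
    and conv: "convex_fun (\<lambda>x. \<phi>1 x - ereal (\<mu> / 2 * (norm x)\<^sup>2))" "convex_fun \<phi>2"
    and \<gamma>: "0 < \<gamma>" "1 / \<gamma> < \<mu>"
    and DRS: "\<And>k. (u k, v k) \<in> DRS \<gamma> \<phi>1 \<phi>2 (s k)"
    and lower: "\<And>k. E0 \<le> envelope_at \<gamma> \<phi>1 \<phi>2 (s k) (u k) (v k)"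
    and ab: "\<phi>1 x = ereal a" "\<phi>2 x = ereal b"
  shows "bounded (range u)"
proof -
  define \<kappa> where "\<kappa> = (\<mu> - 1 / \<gamma>) / 2"
  have \<kappa>: "0 < \<kappa>"
    using \<gamma> by (simp add: \<kappa>_def)
  have "norm (u k - x) \<le> sqrt ((a + b - E0) / \<kappa>)" for k
  proof (rule real_le_rsqrt)
    have "\<kappa> * (norm (x - u k))\<^sup>2 \<le> a + b - E0"
      using strongly_convex_envelope_gap[OF no_minf conv \<gamma>(1) DRS[of k] ab] lower[of k]
      unfolding \<kappa>_def by linarith
    then show "(norm (u k - x))\<^sup>2 \<le> (a + b - E0) / \<kappa>"
      using \<kappa> by (simp add: le_divide_eq mult.commute norm_minus_commute)
  qed
  then have "bounded (range (\<lambda>k. u k - x))"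
    by (auto simp: bounded_iff)
  then have "bounded ((\<lambda>y. x + y) ` range (\<lambda>k. u k - x))"
    by (rule bounded_translation)
  then show ?thesis
    by (simp add: image_image)
qed

text \<open>
  The limit \<open>l\<close> of the envelope is at most the optimal cost. The envelope differs from
  \<open>\<phi>1(u) + \<phi>2(v)\<close> by the inner product of \<open>s - u\<close> with the residual (scaled by \<open>1 / \<gamma>\<close>) and by a multiple
  of the squared residual. The residual lies in \<open>dom \<phi>1 - dom \<phi>2\<close>, so the first term vanishes by the
  bound on that span. Lower semicontinuity at a cluster point of \<open>u\<close> then produces a point of cost \<open>l\<close>,
  and the gap inequality at this point forces the whole sequence to converge to it.
\<close>

lemma strongly_convex_splitting_convergence:
  fixes \<phi>1 \<phi>2 :: "'a::euclidean_space \<Rightarrow> ereal"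
  assumes no_minf: "\<And>x. \<phi>1 x \<noteq> -\<infinity>" "\<And>x. \<phi>2 x \<noteq> -\<infinity>"
    and lsc: "lsc \<phi>1" "lsc \<phi>2"
    and conv: "convex_fun (\<lambda>x. \<phi>1 x - ereal (\<mu> / 2 * (norm x)\<^sup>2))" "convex_fun \<phi>2"
    and \<mu>: "0 < \<mu>" and \<gamma>: "0 < \<gamma>" "1 / \<gamma> < \<mu>"
    and rel: "0 \<in> rel_interior (set_diff (eff_dom \<phi>1) (eff_dom \<phi>2))"
    and DRS: "\<And>k. (u k, v k) \<in> DRS \<gamma> \<phi>1 \<phi>2 (s k)"
    and E: "\<And>k. E k = envelope_at \<gamma> \<phi>1 \<phi>2 (s k) (u k) (v k)" and mono: "incseq E"
    and residual: "(\<lambda>k. u k - v k) \<longlonglongrightarrow> 0"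
  shows "\<exists>x. argmin (\<lambda>x. \<phi>1 x + \<phi>2 x) = {x} \<and> (\<lambda>k. ereal (E k)) \<longlonglongrightarrow> \<phi>1 x + \<phi>2 x \<and>
      u \<longlonglongrightarrow> x \<and> v \<longlonglongrightarrow> x"
    and "0 \<in> interior (set_diff (eff_dom \<phi>1) (eff_dom \<phi>2)) \<Longrightarrow> bounded (range s)"
proof -
  define D where "D = set_diff (eff_dom \<phi>1) (eff_dom \<phi>2)"
  define \<kappa> where "\<kappa> = (\<mu> - 1 / \<gamma>) / 2"
  have \<kappa>: "0 < \<kappa>"
    using \<gamma> by (simp add: \<kappa>_def)
  have gap: "E k + \<kappa> * (norm (x - u k))\<^sup>2 \<le> a + b" if "\<phi>1 x = ereal a" "\<phi>2 x = ereal b" for k x a b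
    using strongly_convex_envelope_gap[OF no_minf conv \<gamma>(1) DRS that] by (simp add: E \<kappa>_def)
  then have upper: "E k \<le> a + b" if "\<phi>1 x = ereal a" "\<phi>2 x = ereal b" for k x a b
    using gap[OF that, of k] \<kappa> by (smt (verit) mult_nonneg_nonneg zero_le_power2)
  have "0 \<in> D"
    using rel rel_interior_subset unfolding D_def by blast
  then obtain x y a0 b0 where "0 = x - y" "\<phi>1 x = ereal a0" "\<phi>2 y = ereal b0"
    using set_diff_eff_domE[of 0 \<phi>1 \<phi>2] no_minf unfolding D_def by metis
  then obtain x0 where x0: "\<phi>1 x0 = ereal a0" "\<phi>2 x0 = ereal b0"
    by simp
  have lower: "E 0 \<le> envelope_at \<gamma> \<phi>1 \<phi>2 (s k) (u k) (v k)" for k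
    using incseqD[OF mono, of 0 k] by (simp add: E)
  have bounded_u: "bounded (range u)"
    by (rule strongly_convex_splitting_primal_bounded[where s = s and u = u and v = v,
          OF no_minf conv \<gamma> DRS lower x0])
  have "bounded (range (\<lambda>k. u k - v k))"
    using convergent_imp_bounded residual by blast
  with bounded_u have bounded_v: "bounded (range v)"
    using bounded_minus_comp[of u UNIV "\<lambda>k. u k - v k"] by simp
  obtain B where B: "\<And>k w. w \<in> span D \<Longrightarrow> \<bar>(s k - u k) \<bullet> w\<bar> \<le> B * norm w"
    using strongly_convex_splitting_dual_bounded[where s = s and u = u and v = v, OF no_minf conv \<mu> \<gamma>(1) rel DRS lower bounded_u bounded_v]
    unfolding D_def by blast
  obtain l where l: "E \<longlonglongrightarrow> l"
    using incseq_convergent[OF mono] upper[OF x0] by metis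
  have "(\<lambda>k. (s k - u k) \<bullet> (u k - v k)) \<longlonglongrightarrow> 0"
  proof (rule Lim_null_comparison)
    have "u k - v k \<in> span D" for k
      unfolding D_def using DRS_eff_dom[OF no_minf DRS[of k]] by (intro span_base set_diffI)
    then show "\<forall>\<^sub>F k in sequentially. norm ((s k - u k) \<bullet> (u k - v k)) \<le> B * norm (u k - v k)"
      using B by simp
    show "(\<lambda>k. B * norm (u k - v k)) \<longlonglongrightarrow> 0"
      using tendsto_mult_right_zero[OF tendsto_norm_zero[OF residual]] .
  qed
  then have "(\<lambda>k. E k + 1 / \<gamma> * ((s k - u k) \<bullet> (u k - v k)) - 1 / (2 * \<gamma>) * (norm (u k - v k))\<^sup>2)
      \<longlonglongrightarrow> l + 1 / \<gamma> * 0 - 1 / (2 * \<gamma>) * (norm (0::'a))\<^sup>2"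
    by (intro tendsto_intros l residual)
  moreover have split_E: "E k + 1 / \<gamma> * ((s k - u k) \<bullet> (u k - v k)) - 1 / (2 * \<gamma>) * (norm (u k - v k))\<^sup>2
      = real_of_ereal (\<phi>1 (u k)) + real_of_ereal (\<phi>2 (v k))" for k
  proof -
    have "(s k - u k) \<bullet> (v k - u k) = - ((s k - u k) \<bullet> (u k - v k))"
      by (metis inner_minus_right minus_diff_eq)
    then show ?thesis
      by (simp add: E envelope_at_def norm_minus_commute)
  qed
  ultimately have lim_values: "(\<lambda>k. real_of_ereal (\<phi>1 (u k)) + real_of_ereal (\<phi>2 (v k))) \<longlonglongrightarrow> l"
    by simp
  have finite: "\<phi>1 (u k) + \<phi>2 (v k) = ereal (real_of_ereal (\<phi>1 (u k)) + real_of_ereal (\<phi>2 (v k)))" for k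
    using DRS_eff_dom[OF no_minf DRS[of k]] no_minf(1)[of "u k"] no_minf(2)[of "v k"]
    by (cases "\<phi>1 (u k)"; cases "\<phi>2 (v k)") (auto simp: eff_dom_def)
  obtain x \<rho> where \<rho>: "strict_mono (\<rho> :: nat \<Rightarrow> nat)" and x: "(u \<circ> \<rho>) \<longlonglongrightarrow> x"
    using bounded_imp_convergent_subsequence[OF bounded_u] by blast
  have "(\<lambda>k. u (\<rho> k) - (u (\<rho> k) - v (\<rho> k))) \<longlonglongrightarrow> x - 0"
    using x LIMSEQ_subseq_LIMSEQ[OF residual \<rho>] by (intro tendsto_diff) (auto simp: o_def)
  then have x': "(\<lambda>k. v (\<rho> k)) \<longlonglongrightarrow> x"
    by simp
  have "\<phi>1 x + \<phi>2 x \<le> ereal l"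
  proof (rule lsc_add_le_limit[OF lsc no_minf _ x'])
    show "(\<lambda>k. u (\<rho> k)) \<longlonglongrightarrow> x"
      using x by (simp add: o_def)
    show "\<phi>1 (u (\<rho> k)) + \<phi>2 (v (\<rho> k))
        \<le> ereal (real_of_ereal (\<phi>1 (u (\<rho> k))) + real_of_ereal (\<phi>2 (v (\<rho> k))))" for k
      by (simp add: finite)
    show "(\<lambda>k. real_of_ereal (\<phi>1 (u (\<rho> k))) + real_of_ereal (\<phi>2 (v (\<rho> k)))) \<longlonglongrightarrow> l"
      using LIMSEQ_subseq_LIMSEQ[OF lim_values \<rho>] by (simp add: o_def)
  qed
  then obtain a b where ab: "\<phi>1 x = ereal a" "\<phi>2 x = ereal b" and "a + b \<le> l"
    using no_minf(1)[of x] no_minf(2)[of x] by (cases "\<phi>1 x"; cases "\<phi>2 x") auto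
  have minimal: "l \<le> a' + b'" if "\<phi>1 y = ereal a'" "\<phi>2 y = ereal b'" for y a' b'
    using l upper[OF that] by (intro LIMSEQ_le_const2) auto
  have sum: "a + b = l"
    using minimal[OF ab] \<open>a + b \<le> l\<close> by simp
  \<comment> \<open>Applied to any minimizer, this also gives uniqueness.\<close>
  have u_lim: "u \<longlonglongrightarrow> y" if "\<phi>1 y = ereal a'" "\<phi>2 y = ereal b'" "a' + b' = l" for y a' b'
  proof -
    have bound: "(norm (u k - y))\<^sup>2 \<le> (l - E k) / \<kappa>" for k
      using gap[OF that(1,2), of k] \<kappa> that(3)
      by (simp add: le_divide_eq norm_minus_commute mult.commute)
    have "(\<lambda>k. (norm (u k - y))\<^sup>2) \<longlonglongrightarrow> 0"
    proof (rule Lim_null_comparison)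
      show "\<forall>\<^sub>F k in sequentially. norm ((norm (u k - y))\<^sup>2) \<le> (l - E k) / \<kappa>"
        using bound by simp
      show "(\<lambda>k. (l - E k) / \<kappa>) \<longlonglongrightarrow> 0"
        using l \<kappa> by (auto intro!: tendsto_eq_intros)
    qed
    then have "(\<lambda>k. sqrt ((norm (u k - y))\<^sup>2)) \<longlonglongrightarrow> sqrt 0"
      by (rule tendsto_real_sqrt)
    then have "(\<lambda>k. u k - y) \<longlonglongrightarrow> 0"
      by (simp add: tendsto_norm_zero_iff)
    then show ?thesis
      by (rule LIM_zero_cancel)
  qed
  have le: "\<phi>1 x + \<phi>2 x \<le> \<phi>1 y + \<phi>2 y" for y
    using minimal[of y] sum no_minf(1)[of y] no_minf(2)[of y]
    by (cases "\<phi>1 y"; cases "\<phi>2 y") (auto simp: ab)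
  have "argmin (\<lambda>x. \<phi>1 x + \<phi>2 x) = {x}"
  proof (intro equalityI subsetI)
    fix y assume y: "y \<in> argmin (\<lambda>x. \<phi>1 x + \<phi>2 x)"
    then have "\<phi>1 y + \<phi>2 y \<le> \<phi>1 x + \<phi>2 x"
      by (simp add: argmin_def)
    then have "\<phi>1 y + \<phi>2 y = ereal l"
      using le[of y] sum by (simp add: ab)
    then obtain a' b' where "\<phi>1 y = ereal a'" "\<phi>2 y = ereal b'" "a' + b' = l"
      using no_minf(1)[of y] no_minf(2)[of y] by (cases "\<phi>1 y"; cases "\<phi>2 y") auto
    then have "y = x"
      using LIMSEQ_unique[OF u_lim u_lim[OF ab sum]] by blast
    then show "y \<in> {x}"
      by simp
  qed (use le in \<open>auto simp: argmin_def ab\<close>)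
  moreover have "(\<lambda>k. ereal (E k)) \<longlonglongrightarrow> \<phi>1 x + \<phi>2 x"
    using l by (simp add: ab sum)
  moreover have "u \<longlonglongrightarrow> x"
    by (rule u_lim[OF ab sum])
  moreover from this have "v \<longlonglongrightarrow> x"
    using tendsto_diff[OF _ residual, of u x] by simp
  ultimately show "\<exists>x. argmin (\<lambda>x. \<phi>1 x + \<phi>2 x) = {x} \<and> (\<lambda>k. ereal (E k)) \<longlonglongrightarrow> \<phi>1 x + \<phi>2 x \<and>
      u \<longlonglongrightarrow> x \<and> v \<longlonglongrightarrow> x"
    by blast
  show "bounded (range s)" if int: "0 \<in> interior (set_diff (eff_dom \<phi>1) (eff_dom \<phi>2))"
  proof -
    have "span D = UNIV"
    proof -
      obtain e where "0 < e" "ball 0 e \<subseteq> D"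
        using int by (auto simp: mem_interior D_def)
      then show ?thesis
        using span_mono[of "ball 0 e" D] affine_hull_subset_span[of "ball 0 e"]
          affine_hull_open[of "ball (0::'a) e"] by auto
    qed
    have "norm (s k - u k) \<le> max B 0" for k
    proof -
      have "norm (s k - u k) * norm (s k - u k) \<le> B * norm (s k - u k)"
        using B[of "s k - u k" k] \<open>span D = UNIV\<close>
        by (simp add: power2_norm_eq_inner[symmetric] power2_eq_square)
      then show ?thesis
        by (cases "s k = u k") (auto simp: le_max_iff_disj)
    qed
    then have "bounded (range (\<lambda>k. s k - u k))"
      by (auto simp: bounded_iff)
    then show ?thesis
      using bounded_plus_comp[OF _ bounded_u, of "\<lambda>k. s k - u k"] by simp
  qed
qed

section \<open>Level boundedness of the dual cost\<close>

text \<open>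
  If zero is an interior point, the two suprema that define the conjugates, tested at points \<open>x\<close>
  and \<open>z\<close> with \<open>x - z = - w\<close>, bound \<open>y \<bullet> w\<close> on every sublevel set of the dual cost. Otherwise some
  \<open>n \<noteq> 0\<close> is orthogonal to \<open>dom \<phi>1 - dom \<phi>2\<close>, so \<open>n \<bullet> _\<close> has the same constant value on both domains and
  the dual cost is constant along \<open>n\<close>. The oracle pair \<open>(u, v)\<close> supplies a starting point \<open>z\<close>, a subgradient
  of \<open>\<phi>2\<close>, at which the dual cost is finite: \<open>\<phi>2\<^sup>*\<close> is finite at subgradients of \<open>\<phi>2\<close>, and strong convexity
  makes \<open>\<phi>1\<^sup>*\<close> finite everywhere.
\<close>

lemma dual_level_bounded_iff:
  fixes \<phi>1 \<phi>2 :: "'a::euclidean_space \<Rightarrow> ereal"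
  assumes no_minf: "\<And>x. \<phi>1 x \<noteq> -\<infinity>" "\<And>x. \<phi>2 x \<noteq> -\<infinity>"
    and conv: "convex_fun (\<lambda>x. \<phi>1 x - ereal (\<mu> / 2 * (norm x)\<^sup>2))" "convex_fun \<phi>2"
    and \<mu>: "0 < \<mu>" and \<gamma>: "0 < \<gamma>"
    and rel: "0 \<in> rel_interior (set_diff (eff_dom \<phi>1) (eff_dom \<phi>2))"
    and DRS: "(u, v) \<in> DRS \<gamma> \<phi>1 \<phi>2 s"
  shows "0 \<in> interior (set_diff (eff_dom \<phi>1) (eff_dom \<phi>2)) \<longleftrightarrow>
    level_bounded (\<lambda>y. conjugate \<phi>1 (- y) + conjugate \<phi>2 y)"
proof
  define D where "D = set_diff (eff_dom \<phi>1) (eff_dom \<phi>2)"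
  {
    assume "0 \<in> interior (set_diff (eff_dom \<phi>1) (eff_dom \<phi>2))"
    then obtain e where e: "0 < e" "ball 0 e \<subseteq> D"
      by (auto simp: mem_interior D_def)
    show "level_bounded (\<lambda>y. conjugate \<phi>1 (- y) + conjugate \<phi>2 y)"
      unfolding level_bounded_def
    proof
      fix \<alpha> :: real
      define Y where "Y = {y. conjugate \<phi>1 (- y) + conjugate \<phi>2 y \<le> ereal \<alpha>}"
      have "\<exists>B. \<forall>y\<in>Y. y \<bullet> w \<le> B" if "norm w < e" for w
      proof -
        have "- w \<in> D"
          using e that by auto
        obtain x z a b where w: "- w = x - z" and ab: "\<phi>1 x = ereal a" "\<phi>2 z = ereal b"
          using set_diff_eff_domE[OF \<open>- w \<in> D\<close>[unfolded D_def] no_minf] .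
        have "y \<bullet> w \<le> \<alpha> + a + b" if "y \<in> Y" for y
        proof -
          have "ereal ((- y) \<bullet> x) - \<phi>1 x \<le> conjugate \<phi>1 (- y)"
            unfolding conjugate_def by (rule SUP_upper) simp
          moreover have "ereal (y \<bullet> z) - \<phi>2 z \<le> conjugate \<phi>2 y"
            unfolding conjugate_def by (rule SUP_upper) simp
          ultimately have "ereal ((- y) \<bullet> x) - \<phi>1 x + (ereal (y \<bullet> z) - \<phi>2 z) \<le> ereal \<alpha>"
            using that unfolding Y_def by (auto intro: order_trans[OF add_mono])
          then have "(- y) \<bullet> x - a + (y \<bullet> z - b) \<le> \<alpha>"
            by (simp add: ab)
          moreover have "w = z - x"
            using w by (metis minus_diff_eq minus_minus)
          then have "y \<bullet> w = y \<bullet> z - y \<bullet> x"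
            by (simp add: inner_diff_right)
          ultimately show ?thesis
            by simp
        qed
        then show ?thesis
          by blast
      qed
      then obtain B where B: "\<And>y w. y \<in> Y \<Longrightarrow> w \<in> UNIV \<Longrightarrow> \<bar>y \<bullet> w\<bar> \<le> B * norm w"
        using bounded_above_near_zero_imp_bounded[OF subspace_UNIV e(1), of Y] by blast
      have "norm y \<le> max B 0" if "y \<in> Y" for y
      proof -
        have "norm y * norm y \<le> B * norm y"
          using B[OF that, of y] by (simp add: power2_norm_eq_inner[symmetric] power2_eq_square)
        then show ?thesis
          by (cases "y = 0") (auto simp: le_max_iff_disj)
      qed
      then show "bounded Y"
        by (auto simp: bounded_iff)
    qed
  }
  assume level: "level_bounded (\<lambda>y. conjugate \<phi>1 (- y) + conjugate \<phi>2 y)"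
  have "span D = UNIV"
  proof (rule ccontr)
    assume "span D \<noteq> UNIV"
    then obtain n where n: "n \<noteq> 0" "\<And>w. w \<in> D \<Longrightarrow> n \<bullet> w = 0"
      using span_not_UNIV_orthogonal[of D] span_base[of _ D] by blast
    have u: "u \<in> prox \<gamma> \<phi>1 s" and v: "v \<in> prox \<gamma> \<phi>2 (2 *\<^sub>R u - s)"
      using DRS by (auto simp: DRS_def)
    have dom: "u \<in> eff_dom \<phi>1" "v \<in> eff_dom \<phi>2"
      by (rule DRS_eff_dom[OF no_minf DRS])+
    define a b where "a = real_of_ereal (\<phi>1 u)" and "b = real_of_ereal (\<phi>2 v)"
    define z where "z = (1 / \<gamma>) *\<^sub>R (2 *\<^sub>R u - s - v)"
    \<comment> \<open>The subgradient \<open>(s - u) / \<gamma>\<close> of \<open>\<phi>1\<close> at \<open>u\<close> equals \<open>q - z\<close>.\<close>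
    define q where "q = z + (1 / \<gamma>) *\<^sub>R (s - u)"
    define M where "M = (norm q)\<^sup>2 / (2 * \<mu>) - z \<bullet> u - a + z \<bullet> v - b"
    have level_z: "conjugate \<phi>1 (- (z + t *\<^sub>R n)) + conjugate \<phi>2 (z + t *\<^sub>R n) \<le> ereal M" for t
    proof -
      have "conjugate \<phi>2 (z + t *\<^sub>R n) \<le> ereal (z \<bullet> v + t * (n \<bullet> v) - b)"
        unfolding conjugate_def
      proof (rule SUP_least)
        fix x
        show "ereal ((z + t *\<^sub>R n) \<bullet> x) - \<phi>2 x \<le> ereal (z \<bullet> v + t * (n \<bullet> v) - b)"
        proof (cases "\<phi>2 x")
          case (real d)
          then have "x \<in> eff_dom \<phi>2"
            by (simp add: eff_dom_def)
          with dom have "u - x \<in> D" "u - v \<in> D"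
            unfolding D_def by (auto intro: set_diffI)
          then have "n \<bullet> x = n \<bullet> v"
            using n(2) by (metis inner_diff_right right_minus_eq)
          moreover have "b + z \<bullet> (x - v) \<le> d"
            using prox_subgradient[OF no_minf(2) _ \<gamma> v real, of 0] conv(2)
            by (simp add: zero_ereal_def[symmetric] b_def z_def)
          ultimately show ?thesis
            by (simp add: real inner_add_left inner_diff_right)
        qed (use no_minf(2) in auto)
      qed
      moreover have "conjugate \<phi>1 (- (z + t *\<^sub>R n))
          \<le> ereal ((norm q)\<^sup>2 / (2 * \<mu>) - z \<bullet> u - a - t * (n \<bullet> v))"
        unfolding conjugate_def
      proof (rule SUP_least)
        fix x
        show "ereal (- (z + t *\<^sub>R n) \<bullet> x) - \<phi>1 x
            \<le> ereal ((norm q)\<^sup>2 / (2 * \<mu>) - z \<bullet> u - a - t * (n \<bullet> v))"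
        proof (cases "\<phi>1 x")
          case (real d)
          then have "x \<in> eff_dom \<phi>1"
            by (simp add: eff_dom_def)
          with dom have "x - v \<in> D"
            unfolding D_def by (auto intro: set_diffI)
          then have nx: "n \<bullet> x = n \<bullet> v"
            using n(2) by (metis inner_diff_right right_minus_eq)
          have "a + (q - z) \<bullet> (x - u) + \<mu> / 2 * (norm (x - u))\<^sup>2 \<le> d"
            using prox_subgradient[OF no_minf(1) conv(1) \<gamma> u real] by (simp add: a_def q_def)
          moreover have "0 \<le> (norm (q + \<mu> *\<^sub>R (x - u)))\<^sup>2 / (2 * \<mu>)"
            using \<mu> by simp
          moreover have "(norm (q + \<mu> *\<^sub>R (x - u)))\<^sup>2 / (2 * \<mu>)
              = (norm q)\<^sup>2 / (2 * \<mu>) + q \<bullet> (x - u) + \<mu> / 2 * (norm (x - u))\<^sup>2"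
          proof -
            have "(norm (q + \<mu> *\<^sub>R (x - u)))\<^sup>2
                = (norm q)\<^sup>2 + 2 * \<mu> * (q \<bullet> (x - u)) + \<mu>\<^sup>2 * (norm (x - u))\<^sup>2"
              unfolding power2_norm_eq_inner by (simp add: inner_add inner_commute power2_eq_square)
            then show ?thesis
              using \<mu> by (simp add: add_divide_distrib power2_eq_square)
          qed
          ultimately have "- (z \<bullet> x) - d \<le> (norm q)\<^sup>2 / (2 * \<mu>) - z \<bullet> u - a"
            by (simp add: inner_diff_left inner_diff_right)
          then show ?thesis
            by (simp add: real nx inner_add_left inner_diff_left)
        qed (use no_minf(1) in auto)
      qed
      ultimately have "conjugate \<phi>1 (- (z + t *\<^sub>R n)) + conjugate \<phi>2 (z + t *\<^sub>R n)
          \<le> ereal ((norm q)\<^sup>2 / (2 * \<mu>) - z \<bullet> u - a - t * (n \<bullet> v)) + ereal (z \<bullet> v + t * (n \<bullet> v) - b)"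
        by (intro add_mono)
      then show ?thesis
        by (simp add: M_def algebra_simps)
    qed
    have "bounded {y. conjugate \<phi>1 (- y) + conjugate \<phi>2 y \<le> ereal M}"
      using level by (simp add: level_bounded_def)
    then obtain K where "\<forall>y\<in>{y. conjugate \<phi>1 (- y) + conjugate \<phi>2 y \<le> ereal M}. norm y \<le> K"
      unfolding bounded_iff by (rule exE)
    then have K: "norm (z + t *\<^sub>R n) \<le> K" for t
      using level_z by blast
    \<comment> \<open>A multiple of \<open>n\<close> that leaves the ball of radius \<open>K\<close> from the starting point \<open>z\<close>.\<close>
    define t where "t = (K + norm z + 1) / norm n"
    have "0 \<le> K"
      by (rule order_trans[OF norm_ge_zero K])
    then have "norm (t *\<^sub>R n) = K + norm z + 1"
      using n(1) by (simp add: t_def)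
    moreover have "norm (t *\<^sub>R n) \<le> norm (z + t *\<^sub>R n) + norm z"
      using norm_triangle_ineq4[of "z + t *\<^sub>R n" z] by simp
    ultimately show False
      using K[of t] by simp
  qed
  moreover obtain e where "0 < e" "\<And>w. w \<in> span D \<Longrightarrow> norm w < e \<Longrightarrow> w \<in> D"
    using zero_rel_interior_imp_ball_in_span[OF rel] unfolding D_def by blast
  ultimately have "ball 0 e \<subseteq> D"
    by auto
  with \<open>0 < e\<close> show "0 \<in> interior (set_diff (eff_dom \<phi>1) (eff_dom \<phi>2))"
    unfolding D_def mem_interior by blast
qed

section \<open>Limits in the smooth case\<close>

text \<open>
  A proximal point \<open>u\<close> satisfies \<open>s = u + \<gamma> \<nabla>f(u)\<close>, and \<open>\<gamma> \<nabla>f\<close> is a contraction.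
\<close>

lemma smooth_prox_unique:
  fixes f :: "'a::real_inner \<Rightarrow> real"
  assumes deriv: "\<And>x. (f has_derivative (\<lambda>h. G x \<bullet> h)) (at x)"
    and lip: "L-lipschitz_on UNIV G" and \<gamma>: "0 < \<gamma>" "\<gamma> * L < 1"
    and u: "u \<in> prox \<gamma> (\<lambda>x. ereal (f x)) s" and u': "u' \<in> prox \<gamma> (\<lambda>x. ereal (f x)) s"
  shows "u = u'"
proof -
  have "u + \<gamma> *\<^sub>R G u = u' + \<gamma> *\<^sub>R G u'"
    using prox_differentiable_optimality[OF deriv \<gamma>(1)] u u' by metis
  then have "u - u' = \<gamma> *\<^sub>R (G u' - G u)"
    by (simp add: algebra_simps)
  then have "norm (u - u') = \<gamma> * norm (G u' - G u)"
    using \<gamma> by simp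
  also have "\<dots> \<le> \<gamma> * (L * norm (u - u'))"
    using lipschitz_onD[OF lip, of u' u] \<gamma>
    by (intro mult_left_mono) (auto simp: dist_norm norm_minus_commute)
  finally have "(1 - \<gamma> * L) * norm (u - u') \<le> 0"
    by (simp add: algebra_simps)
  then have "norm (u - u') \<le> 0"
    using \<gamma> by (simp add: mult_le_0_iff)
  then show ?thesis
    by simp
qed

lemma smooth_envelope_lower_bound:
  fixes f :: "'a::real_inner \<Rightarrow> real"
  assumes deriv: "\<And>x. (f has_derivative (\<lambda>h. G x \<bullet> h)) (at x)"
    and lip: "L-lipschitz_on UNIV G" and \<gamma>: "0 < \<gamma>" "\<gamma> * L < 1"
    and uv: "(u, v) \<in> DRS \<gamma> (\<lambda>x. ereal (f x)) \<phi>2 s"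
  shows "f v + real_of_ereal (\<phi>2 v) \<le> envelope_at \<gamma> (\<lambda>x. ereal (f x)) \<phi>2 s u v"
proof -
  have "s = u + \<gamma> *\<^sub>R G u"
    using uv by (intro prox_differentiable_optimality[OF deriv \<gamma>(1)]) (simp add: DRS_def)
  then have "envelope_at \<gamma> (\<lambda>x. ereal (f x)) \<phi>2 s u v
      = f u + real_of_ereal (\<phi>2 v) + G u \<bullet> (v - u) + 1 / (2 * \<gamma>) * (norm (v - u))\<^sup>2"
    using \<gamma> by (simp add: envelope_at_def)
  moreover have "f v \<le> f u + G u \<bullet> (v - u) + L / 2 * (norm (v - u))\<^sup>2"
    by (rule lipschitz_gradient_upper_bound[OF deriv lip])
  moreover have "L / 2 * (norm (v - u))\<^sup>2 \<le> 1 / (2 * \<gamma>) * (norm (v - u))\<^sup>2"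
    using \<gamma> by (intro mult_right_mono) (simp_all add: field_simps)
  ultimately show ?thesis
    by linarith
qed

text \<open>
  Proximal optimality passes to the limit: for \<open>f\<close> by continuity, and for \<open>\<phi>2\<close> by lower semicontinuity.
  The values \<open>\<phi>2(V n)\<close> themselves converge, because comparing \<open>V n\<close> with the limit point bounds their upper
  limit by \<open>\<phi>2(x)\<close>.
\<close>

lemma smooth_DRS_limit:
  fixes f :: "'a::euclidean_space \<Rightarrow> real"
  assumes deriv: "\<And>x. (f has_derivative (\<lambda>h. G x \<bullet> h)) (at x)"
    and lip: "L-lipschitz_on UNIV G" and \<gamma>: "0 < \<gamma>"
    and no_minf: "\<And>x. \<phi>2 x \<noteq> -\<infinity>" and lsc: "lsc \<phi>2"
    and DRS: "\<And>n. (U n, V n) \<in> DRS \<gamma> (\<lambda>x. ereal (f x)) \<phi>2 (S n)"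
    and U: "U \<longlonglongrightarrow> x" and V: "V \<longlonglongrightarrow> x"
  shows "(x, x) \<in> DRS \<gamma> (\<lambda>x. ereal (f x)) \<phi>2 (x + \<gamma> *\<^sub>R G x)"
    and "(\<lambda>n. envelope_at \<gamma> (\<lambda>x. ereal (f x)) \<phi>2 (S n) (U n) (V n)) \<longlonglongrightarrow> f x + real_of_ereal (\<phi>2 x)"
proof -
  define s where "s = x + \<gamma> *\<^sub>R G x"
  define b where "b n = real_of_ereal (\<phi>2 (V n))" for n
  define Q where "Q n = 2 *\<^sub>R U n - S n" for n
  have proxU: "U n \<in> prox \<gamma> (\<lambda>x. ereal (f x)) (S n)" and proxV: "V n \<in> prox \<gamma> \<phi>2 (Q n)" for n
    using DRS[of n] by (auto simp: DRS_def Q_def)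
  have b: "\<phi>2 (V n) = ereal (b n)" for n
    using prox_finite[OF proxV no_minf] by (simp add: b_def)
  have "continuous_on UNIV G"
    by (rule lipschitz_on_continuous_on[OF lip])
  then have "(\<lambda>n. G (U n)) \<longlonglongrightarrow> G x"
    using U by (intro isCont_tendsto_compose[of x G]) (auto simp: continuous_on_eq_continuous_at)
  then have "(\<lambda>n. U n + \<gamma> *\<^sub>R G (U n)) \<longlonglongrightarrow> s"
    unfolding s_def by (intro tendsto_intros U)
  moreover have "S = (\<lambda>n. U n + \<gamma> *\<^sub>R G (U n))"
    by (rule ext) (rule prox_differentiable_optimality[OF deriv \<gamma> proxU])
  ultimately have S: "S \<longlonglongrightarrow> s"
    by simp
  have fU: "(\<lambda>n. f (U n)) \<longlonglongrightarrow> f x"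
    using U has_derivative_continuous[OF deriv] by (intro isCont_tendsto_compose[of x f]) auto
  have Q: "Q \<longlonglongrightarrow> 2 *\<^sub>R x - s"
    unfolding Q_def by (intro tendsto_intros U S)
  have "f x + 1 / (2 * \<gamma>) * (norm (x - s))\<^sup>2 \<le> f w + 1 / (2 * \<gamma>) * (norm (w - s))\<^sup>2" for w
  proof (rule LIMSEQ_le)
    show "(\<lambda>n. f (U n) + 1 / (2 * \<gamma>) * (norm (U n - S n))\<^sup>2) \<longlonglongrightarrow> f x + 1 / (2 * \<gamma>) * (norm (x - s))\<^sup>2"
      by (intro tendsto_intros fU U S)
    show "(\<lambda>n. f w + 1 / (2 * \<gamma>) * (norm (w - S n))\<^sup>2) \<longlonglongrightarrow> f w + 1 / (2 * \<gamma>) * (norm (w - s))\<^sup>2"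
      by (intro tendsto_intros S)
    show "\<exists>N. \<forall>n\<ge>N. f (U n) + 1 / (2 * \<gamma>) * (norm (U n - S n))\<^sup>2 \<le> f w + 1 / (2 * \<gamma>) * (norm (w - S n))\<^sup>2"
      using prox_le[OF proxU, where x = w and b = "f w"] by simp
  qed
  then have prox1: "x \<in> prox \<gamma> (\<lambda>x. ereal (f x)) s"
    by (intro proxI[where a = "f x"]) auto
  have upper_lim: "(\<lambda>n. \<beta> + 1 / (2 * \<gamma>) * (norm (w - Q n))\<^sup>2 - 1 / (2 * \<gamma>) * (norm (V n - Q n))\<^sup>2)
      \<longlonglongrightarrow> \<beta> + 1 / (2 * \<gamma>) * (norm (w - (2 *\<^sub>R x - s)))\<^sup>2 - 1 / (2 * \<gamma>) * (norm (x - (2 *\<^sub>R x - s)))\<^sup>2" for \<beta> w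
    by (intro tendsto_intros V Q)
  have upper: "b n \<le> \<beta> + 1 / (2 * \<gamma>) * (norm (w - Q n))\<^sup>2 - 1 / (2 * \<gamma>) * (norm (V n - Q n))\<^sup>2"
    if "\<phi>2 w = ereal \<beta>" for w \<beta> n
    using prox_le[OF proxV[of n] no_minf that] by (simp add: b_def)
  have limit_le: "\<phi>2 x \<le> ereal (\<beta> + 1 / (2 * \<gamma>) * (norm (w - (2 *\<^sub>R x - s)))\<^sup>2
      - 1 / (2 * \<gamma>) * (norm (x - (2 *\<^sub>R x - s)))\<^sup>2)" if "\<phi>2 w = ereal \<beta>" for w \<beta>
    using upper[OF that] by (intro lsc_le_limit[OF lsc V _ upper_lim]) (simp add: b)
  obtain b' where b': "\<phi>2 x = ereal b'"
    using limit_le[OF b[of 0]] no_minf[of x] by (cases "\<phi>2 x") auto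
  have "x \<in> prox \<gamma> \<phi>2 (2 *\<^sub>R x - s)"
    using limit_le b' by (intro proxI[where h = \<phi>2, OF no_minf b']) (auto simp: algebra_simps)
  with prox1 show "(x, x) \<in> DRS \<gamma> (\<lambda>x. ereal (f x)) \<phi>2 (x + \<gamma> *\<^sub>R G x)"
    by (simp add: DRS_def s_def)
  have "b \<longlonglongrightarrow> b'"
  proof (rule order_tendstoI)
    fix a assume "a < b'"
    then have "\<forall>\<^sub>F n in sequentially. ereal a < \<phi>2 (V n)"
      by (intro lsc_eventually_greater[OF lsc _ V]) (simp add: b')
    then show "\<forall>\<^sub>F n in sequentially. a < b n"
      by (simp add: b)
  next
    fix a assume "b' < a"
    then have "\<forall>\<^sub>F n in sequentially.
        b' + 1 / (2 * \<gamma>) * (norm (x - Q n))\<^sup>2 - 1 / (2 * \<gamma>) * (norm (V n - Q n))\<^sup>2 < a"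
      by (intro order_tendstoD(2)[OF upper_lim]) simp
    then show "\<forall>\<^sub>F n in sequentially. b n < a"
      by eventually_elim (use upper[OF b'] in \<open>auto intro: le_less_trans\<close>)
  qed
  then have "(\<lambda>n. f (U n) + b n + 1 / \<gamma> * ((S n - U n) \<bullet> (V n - U n)) + 1 / (2 * \<gamma>) * (norm (V n - U n))\<^sup>2)
      \<longlonglongrightarrow> f x + b' + 1 / \<gamma> * ((s - x) \<bullet> (x - x)) + 1 / (2 * \<gamma>) * (norm (x - x))\<^sup>2"
    by (intro tendsto_intros fU U V S)
  then show "(\<lambda>n. envelope_at \<gamma> (\<lambda>x. ereal (f x)) \<phi>2 (S n) (U n) (V n)) \<longlonglongrightarrow> f x + real_of_ereal (\<phi>2 x)"
    by (simp add: envelope_at_def b b')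
qed

lemma regular_subdiff_subset_limiting_subdiff:
  "regular_subdiff h x \<subseteq> limiting_subdiff h x"
proof
  fix v assume v: "v \<in> regular_subdiff h x"
  then have "x \<in> eff_dom h"
    by (cases "h x") (auto simp: regular_subdiff_def eff_dom_def)
  with v show "v \<in> limiting_subdiff h x"
    unfolding limiting_subdiff_def
    by (intro CollectI conjI exI[of _ "\<lambda>_. x"] exI[of _ "\<lambda>_. v"]) auto
qed

lemma quadratic_minorant_imp_regular_subgradient:
  fixes h :: "'a::euclidean_space \<Rightarrow> ereal"
  assumes x: "h x = ereal a" and minorant: "\<And>y. ereal (a + v \<bullet> (y - x) - M * (norm (y - x))\<^sup>2) \<le> h y"
  shows "v \<in> regular_subdiff h x"
proof -
  have "((\<lambda>y. ereal (- M * norm (y - x))) \<longlongrightarrow> ereal (- M * norm (x - x))) (at x)"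
    by (intro tendsto_intros)
  then have "Liminf (at x) (\<lambda>y. ereal (- M * norm (y - x))) = 0"
    by (intro lim_imp_Liminf) (auto simp: zero_ereal_def)
  moreover have "Liminf (at x) (\<lambda>y. ereal (- M * norm (y - x)))
      \<le> Liminf (at x) (\<lambda>y. (h y - h x - ereal (v \<bullet> (y - x))) / ereal (norm (y - x)))"
  proof (rule Liminf_mono, unfold eventually_at_filter, rule always_eventually, intro allI impI)
    fix y assume "y \<noteq> x"
    then have pos: "0 < norm (y - x)"
      by simp
    show "ereal (- M * norm (y - x)) \<le> (h y - h x - ereal (v \<bullet> (y - x))) / ereal (norm (y - x))"
    proof (cases "h y")
      case (real b)
      then have "- M * norm (y - x) * norm (y - x) \<le> b - a - v \<bullet> (y - x)"
        using minorant[of y] by (simp add: power2_eq_square)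
      then have "- M * norm (y - x) \<le> (b - a - v \<bullet> (y - x)) / norm (y - x)"
        using pos by (simp only: pos_le_divide_eq)
      then show ?thesis
        using pos by (simp add: real x)
    next
      case PInf
      then show ?thesis
        using pos by (simp add: x)
    next
      case MInf
      then show ?thesis
        using minorant[of y] by simp
    qed
  qed
  ultimately show ?thesis
    using x by (simp add: regular_subdiff_def)
qed

text \<open>
  Optimality of \<open>x\<close> in the second proximal step is a quadratic minorant of \<open>\<phi>2\<close> with slope \<open>- \<nabla>f(x)\<close>, and
  the descent lemma gives one of \<open>f\<close> with slope \<open>\<nabla>f(x)\<close>. The slopes cancel in the sum, so zero is even a
  regular subgradient.
\<close>

lemma smooth_fixed_point_stationary:
  fixes f :: "'a::euclidean_space \<Rightarrow> real"
  assumes deriv: "\<And>x. (f has_derivative (\<lambda>h. G x \<bullet> h)) (at x)"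
    and lip: "L-lipschitz_on UNIV G" and \<gamma>: "0 < \<gamma>"
    and no_minf: "\<And>x. \<phi>2 x \<noteq> -\<infinity>"
    and fixed: "(x, x) \<in> DRS \<gamma> (\<lambda>x. ereal (f x)) \<phi>2 (x + \<gamma> *\<^sub>R G x)"
  shows "0 \<in> limiting_subdiff (\<lambda>x. ereal (f x) + \<phi>2 x) x"
proof -
  define b where "b = real_of_ereal (\<phi>2 x)"
  have prox: "x \<in> prox \<gamma> \<phi>2 (2 *\<^sub>R x - (x + \<gamma> *\<^sub>R G x))"
    using fixed by (simp add: DRS_def)
  have "\<phi>2 x = ereal b"
    using prox_finite[OF prox no_minf] by (simp add: b_def)
  have "0 \<in> regular_subdiff (\<lambda>x. ereal (f x) + \<phi>2 x) x"
  proof (rule quadratic_minorant_imp_regular_subgradient[where a = "f x + b" and M = "L / 2 + 1 / (2 * \<gamma>)"])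
    show "ereal (f x) + \<phi>2 x = ereal (f x + b)"
      by (simp add: \<open>\<phi>2 x = ereal b\<close>)
    fix y
    show "ereal (f x + b + 0 \<bullet> (y - x) - (L / 2 + 1 / (2 * \<gamma>)) * (norm (y - x))\<^sup>2) \<le> ereal (f y) + \<phi>2 y"
    proof (cases "\<phi>2 y")
      case (real d)
      have "b + 1 / (2 * \<gamma>) * (norm (x - (2 *\<^sub>R x - (x + \<gamma> *\<^sub>R G x))))\<^sup>2
          \<le> d + 1 / (2 * \<gamma>) * (norm (y - (2 *\<^sub>R x - (x + \<gamma> *\<^sub>R G x))))\<^sup>2"
        using prox_le[OF prox no_minf real] by (simp add: b_def)
      moreover have "x - (2 *\<^sub>R x - (x + \<gamma> *\<^sub>R G x)) = \<gamma> *\<^sub>R G x"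
        "y - (2 *\<^sub>R x - (x + \<gamma> *\<^sub>R G x)) = (y - x) - (- \<gamma> *\<^sub>R G x)"
        by (simp_all add: scaleR_2)
      moreover have "(norm ((y - x) - (- \<gamma> *\<^sub>R G x)))\<^sup>2
          = (norm (y - x))\<^sup>2 + 2 * \<gamma> * (G x \<bullet> (y - x)) + (norm (\<gamma> *\<^sub>R G x))\<^sup>2"
        unfolding norm_diff_square[of "y - x"] by (simp add: inner_commute[of "y - x"])
      ultimately have "b + 1 / (2 * \<gamma>) * (norm (\<gamma> *\<^sub>R G x))\<^sup>2
          \<le> d + 1 / (2 * \<gamma>) * ((norm (y - x))\<^sup>2 + 2 * \<gamma> * (G x \<bullet> (y - x)) + (norm (\<gamma> *\<^sub>R G x))\<^sup>2)"
        by metis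
      also have "\<dots> = d + (1 / (2 * \<gamma>) * (norm (y - x))\<^sup>2 + G x \<bullet> (y - x)) + 1 / (2 * \<gamma>) * (norm (\<gamma> *\<^sub>R G x))\<^sup>2"
        unfolding distrib_left using \<gamma> by simp
      finally have "b \<le> d + 1 / (2 * \<gamma>) * (norm (y - x))\<^sup>2 + G x \<bullet> (y - x)"
        by simp
      moreover have "f x + G x \<bullet> (y - x) - L / 2 * (norm (y - x))\<^sup>2 \<le> f y"
        by (rule lipschitz_gradient_lower_bound[OF deriv lip])
      ultimately show ?thesis
        by (simp add: real distrib_right)
    qed (use no_minf in auto)
  qed
  then show ?thesis
    using regular_subdiff_subset_limiting_subdiff by blast
qed

section \<open>Convergence of the linesearch algorithm\<close>

lemma summable_norm_square_imp_null:
  fixes r :: "nat \<Rightarrow> 'a::real_normed_vector"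
  assumes "summable (\<lambda>k. (norm (r k))\<^sup>2)"
  shows "r \<longlonglongrightarrow> 0"
proof -
  have "(\<lambda>k. sqrt ((norm (r k))\<^sup>2)) \<longlonglongrightarrow> sqrt 0"
    by (rule tendsto_real_sqrt[OF summable_LIMSEQ_zero[OF assms]])
  then show ?thesis
    by (simp add: tendsto_norm_zero_iff)
qed

lemma cluster_points_subset_of_diff_null:
  fixes u v :: "nat \<Rightarrow> 'a::real_normed_vector"
  assumes "(\<lambda>k. u k - v k) \<longlonglongrightarrow> 0"
  shows "cluster_points u \<subseteq> cluster_points v"
proof
  fix x assume "x \<in> cluster_points u"
  then obtain \<rho> where \<rho>: "strict_mono \<rho>" "(u \<circ> \<rho>) \<longlonglongrightarrow> x"
    by (auto simp: cluster_points_def)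
  then have "(\<lambda>k. u (\<rho> k) - (u (\<rho> k) - v (\<rho> k))) \<longlonglongrightarrow> x - 0"
    using LIMSEQ_subseq_LIMSEQ[OF assms \<rho>(1)] by (intro tendsto_diff) (auto simp: o_def)
  with \<rho>(1) show "x \<in> cluster_points v"
    by (auto simp: cluster_points_def o_def)
qed

lemma smooth_linesearch_convergence:
  fixes \<phi>1 \<phi>2 :: "'a::euclidean_space \<Rightarrow> ereal"
  assumes smooth: "smooth_case L \<phi>1 \<phi>2" and params: "smooth_params L \<phi>1 \<gamma> lam c"
    and lam: "0 < lam" "lam < 2"
    and iter: "linesearch_DRS 1 \<gamma> lam c 0 imax \<phi>1 \<phi>2 s u v"
  shows "summable (\<lambda>k. (norm (u k - v k))\<^sup>2)"
    and "cluster_points u = cluster_points v"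
    and "decseq (\<lambda>k. DRE \<gamma> \<phi>1 \<phi>2 (s k))"
    and "\<exists>l::real. (\<lambda>k. DRE \<gamma> \<phi>1 \<phi>2 (s k)) \<longlonglongrightarrow> ereal l \<and>
         (\<forall>x \<in> cluster_points u.
            0 \<in> limiting_subdiff (\<lambda>x. \<phi>1 x + \<phi>2 x) x \<and>
            \<phi>1 x + \<phi>2 x = DRE \<gamma> \<phi>1 \<phi>2 (x + \<gamma> *\<^sub>R gradient (\<lambda>x. real_of_ereal (\<phi>1 x)) x) \<and>
            \<phi>1 x + \<phi>2 x = ereal l)"
    and "level_bounded (\<lambda>x. \<phi>1 x + \<phi>2 x) \<Longrightarrow> bounded (range (\<lambda>k. (s k, u k, v k)))"
proof -
  define f where "f = (\<lambda>x. real_of_ereal (\<phi>1 x))"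
  define G where "G = gradient f"
  have \<phi>1: "\<phi>1 = (\<lambda>x. ereal (f x))"
    using smooth by (auto simp: smooth_case_def f_def ereal_real')
  have no_minf: "\<And>x. \<phi>1 x \<noteq> -\<infinity>" "\<And>x. \<phi>2 x \<noteq> -\<infinity>" and lsc: "lsc \<phi>2"
    using smooth by (simp_all add: smooth_case_def \<phi>1)
  have deriv: "(f has_derivative (\<lambda>h. G x \<bullet> h)) (at x)" for x
    using smooth unfolding G_def by (intro has_derivative_gradient) (simp add: smooth_case_def f_def)
  have lip: "L-lipschitz_on UNIV G"
    using smooth by (simp add: smooth_case_def G_def f_def)
  define m where "m = (if convex_fun \<phi>1 then max (\<gamma> * L - lam / 2) 0 else 1)"
  have m: "m = 1 \<or> m = max (\<gamma> * L - lam / 2) 0 \<and> convex_on UNIV f"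
    using convex_fun_ereal_imp_convex_on[of f] by (simp add: m_def \<phi>1)
  have c: "0 < c" "c < lam / (1 + \<gamma> * L)\<^sup>2 * ((2 - lam) / 2 - \<gamma> * L * m)"
    using params by (auto simp: smooth_params_def C_const_def m_def Let_def)
  have \<gamma>: "0 < \<gamma>" "\<gamma> * L < 1"
    using params lam by (auto simp: smooth_params_def split: if_splits)
  have DRS: "(u k, v k) \<in> DRS \<gamma> \<phi>1 \<phi>2 (s k)" for k
    by (rule linesearch_DRS_in_DRS[OF iter])
  have DRE: "DRE \<gamma> \<phi>1 \<phi>2 s = ereal (envelope_at \<gamma> \<phi>1 \<phi>2 s u v)"
    if "(u, v) \<in> DRS \<gamma> \<phi>1 \<phi>2 s" for s u v
    using smooth_prox_unique[OF deriv lip \<gamma>] by (intro DRE_eq_envelope_at[OF no_minf _ that]) (auto simp: \<phi>1)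
  define E where "E k = envelope_at \<gamma> \<phi>1 \<phi>2 (s k) (u k) (v k)" for k
  have E: "DRE \<gamma> \<phi>1 \<phi>2 (s k) = ereal (E k)" for k
    unfolding E_def by (rule DRE[OF DRS])
  have nominal: "1 * envelope_at \<gamma> \<phi>1 \<phi>2 (s - lam *\<^sub>R (u - v)) u' v'
      \<le> 1 * envelope_at \<gamma> \<phi>1 \<phi>2 s u v - c / \<gamma> * (norm (u - v))\<^sup>2"
    if "(u, v) \<in> DRS \<gamma> \<phi>1 \<phi>2 s" "(u', v') \<in> DRS \<gamma> \<phi>1 \<phi>2 (s - lam *\<^sub>R (u - v))" for s u v u' v'
    using smooth_envelope_decrease[OF deriv lip \<gamma>(1) lam c m no_minf(2)] that unfolding \<phi>1 by simp
  have step: "E (Suc k) \<le> E k - c / \<gamma> * (norm (u k - v k))\<^sup>2" for k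
    using linesearch_DRS_merit_step[OF iter \<gamma>(1) DRE nominal] by (simp add: E_def)
  have value_v: "\<phi>1 (v k) + \<phi>2 (v k) = ereal (f (v k) + real_of_ereal (\<phi>2 (v k)))" for k
    using DRS_eff_dom[OF no_minf DRS[of k]] no_minf(2)[of "v k"]
    by (cases "\<phi>2 (v k)") (auto simp: eff_dom_def \<phi>1)
  have value_v_le: "f (v k) + real_of_ereal (\<phi>2 (v k)) \<le> E k" for k
    unfolding E_def \<phi>1 by (rule smooth_envelope_lower_bound[OF deriv lip \<gamma> DRS[unfolded \<phi>1]])
  obtain z where z: "\<phi>1 z + \<phi>2 z < \<infinity>" "\<And>y. \<phi>1 z + \<phi>2 z \<le> \<phi>1 y + \<phi>2 y"
    using smooth by (auto simp: smooth_case_def argmin_def)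
  then obtain b where b: "\<phi>1 z + \<phi>2 z = ereal b"
    using no_minf(2)[of z] by (cases "\<phi>2 z") (auto simp: \<phi>1)
  have lower: "b \<le> E k" for k
    using z(2)[of "v k"] value_v_le[of k] by (simp add: b value_v)
  note merit = decreasing_merit_convergence[where E = E and a = "\<lambda>k. c / \<gamma> * (norm (u k - v k))\<^sup>2" and m = b,
      OF step _ lower]
  have "summable (\<lambda>k. c / \<gamma> * (norm (u k - v k))\<^sup>2)"
    using merit(1) c \<gamma> by simp
  then show summable: "summable (\<lambda>k. (norm (u k - v k))\<^sup>2)"
    using c \<gamma> summable_cmult_iff[of "c / \<gamma>" "\<lambda>k. (norm (u k - v k))\<^sup>2"] by simp
  have residual: "(\<lambda>k. u k - v k) \<longlonglongrightarrow> 0"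
    by (rule summable_norm_square_imp_null[OF summable])
  have residual': "(\<lambda>k. v k - u k) \<longlonglongrightarrow> 0"
    using tendsto_minus[OF residual] by simp
  show "cluster_points u = cluster_points v"
    using cluster_points_subset_of_diff_null[OF residual] cluster_points_subset_of_diff_null[OF residual']
    by blast
  have dec: "decseq E"
    using merit(2) c \<gamma> by simp
  then show "decseq (\<lambda>k. DRE \<gamma> \<phi>1 \<phi>2 (s k))"
    by (simp add: E decseq_def)
  obtain l where l: "E \<longlonglongrightarrow> l"
    using merit(3) c \<gamma> by (auto simp: convergent_def)
  have "0 \<in> limiting_subdiff (\<lambda>x. \<phi>1 x + \<phi>2 x) x \<and>
      \<phi>1 x + \<phi>2 x = DRE \<gamma> \<phi>1 \<phi>2 (x + \<gamma> *\<^sub>R G x) \<and> \<phi>1 x + \<phi>2 x = ereal l"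
    if cluster: "x \<in> cluster_points u" for x
  proof -
    obtain \<rho> :: "nat \<Rightarrow> nat" where \<rho>: "strict_mono \<rho>" and lim_u: "(\<lambda>k. u (\<rho> k)) \<longlonglongrightarrow> x"
      using cluster by (auto simp: cluster_points_def o_def)
    have "(\<lambda>k. u (\<rho> k) - (u (\<rho> k) - v (\<rho> k))) \<longlonglongrightarrow> x - 0"
      using lim_u LIMSEQ_subseq_LIMSEQ[OF residual \<rho>] by (intro tendsto_diff) (auto simp: o_def)
    then have lim_v: "(\<lambda>k. v (\<rho> k)) \<longlonglongrightarrow> x"
      by simp
    note limit = smooth_DRS_limit[where U = "\<lambda>k. u (\<rho> k)" and V = "\<lambda>k. v (\<rho> k)" and S = "\<lambda>k. s (\<rho> k)",
        OF deriv lip \<gamma>(1) no_minf(2) lsc DRS[unfolded \<phi>1] lim_u lim_v]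
    have fixed: "(x, x) \<in> DRS \<gamma> \<phi>1 \<phi>2 (x + \<gamma> *\<^sub>R G x)"
      using limit(1) by (simp add: \<phi>1)
    have "(\<lambda>k. E (\<rho> k)) \<longlonglongrightarrow> f x + real_of_ereal (\<phi>2 x)"
      using limit(2) by (simp add: E_def \<phi>1)
    then have l_eq: "f x + real_of_ereal (\<phi>2 x) = l"
      using LIMSEQ_unique LIMSEQ_subseq_LIMSEQ[OF l \<rho>] by (fastforce simp: o_def)
    have value_x: "\<phi>1 x + \<phi>2 x = ereal (f x + real_of_ereal (\<phi>2 x))"
      using DRS_eff_dom(2)[OF no_minf fixed] no_minf(2)[of x]
      by (cases "\<phi>2 x") (auto simp: eff_dom_def \<phi>1)
    moreover have "DRE \<gamma> \<phi>1 \<phi>2 (x + \<gamma> *\<^sub>R G x) = ereal (f x + real_of_ereal (\<phi>2 x))"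
      unfolding DRE[OF fixed] by (simp add: envelope_at_def \<phi>1)
    moreover have "0 \<in> limiting_subdiff (\<lambda>x. \<phi>1 x + \<phi>2 x) x"
      using smooth_fixed_point_stationary[OF deriv lip \<gamma>(1) no_minf(2) fixed[unfolded \<phi>1]] by (simp add: \<phi>1)
    ultimately show ?thesis
      by (simp add: l_eq)
  qed
  moreover have "(\<lambda>k. DRE \<gamma> \<phi>1 \<phi>2 (s k)) \<longlonglongrightarrow> ereal l"
    using l by (simp add: E)
  ultimately show "\<exists>l::real. (\<lambda>k. DRE \<gamma> \<phi>1 \<phi>2 (s k)) \<longlonglongrightarrow> ereal l \<and>
         (\<forall>x \<in> cluster_points u.
            0 \<in> limiting_subdiff (\<lambda>x. \<phi>1 x + \<phi>2 x) x \<and>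
            \<phi>1 x + \<phi>2 x = DRE \<gamma> \<phi>1 \<phi>2 (x + \<gamma> *\<^sub>R gradient (\<lambda>x. real_of_ereal (\<phi>1 x)) x) \<and>
            \<phi>1 x + \<phi>2 x = ereal l)"
    unfolding f_def[symmetric] G_def[symmetric] by blast
  show "bounded (range (\<lambda>k. (s k, u k, v k)))" if level: "level_bounded (\<lambda>x. \<phi>1 x + \<phi>2 x)"
  proof -
    have "f (v k) + real_of_ereal (\<phi>2 (v k)) \<le> E 0" for k
      using value_v_le[of k] decseqD[OF dec, of 0 k] by simp
    then have "range v \<subseteq> {x. \<phi>1 x + \<phi>2 x \<le> ereal (E 0)}"
      by (auto simp: value_v)
    then have bounded_v: "bounded (range v)"
      using level unfolding level_bounded_def by (meson bounded_subset)
    have "bounded (range (\<lambda>k. u k - v k))"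
      by (rule convergent_imp_bounded[OF residual])
    then have bounded_u: "bounded (range u)"
      using bounded_plus_comp[of "\<lambda>k. u k - v k" UNIV v] bounded_v by simp
    then obtain B where B: "\<And>k. norm (u k) \<le> B"
      by (auto simp: bounded_iff)
    have "norm (s k) \<le> B + \<gamma> * (norm (G 0) + L * B)" for k
    proof -
      have "norm (G (u k)) \<le> norm (G 0) + norm (G (u k) - G 0)"
        using norm_triangle_ineq[of "G 0" "G (u k) - G 0"] by simp
      also have "norm (G (u k) - G 0) \<le> L * norm (u k)"
        using lipschitz_onD[OF lip, of "u k" 0] by (simp add: dist_norm)
      also have "\<dots> \<le> L * B"
        using B lipschitz_on_nonneg[OF lip] by (intro mult_left_mono)
      finally have "\<gamma> * norm (G (u k)) \<le> \<gamma> * (norm (G 0) + L * B)"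
        using \<gamma> by (intro mult_left_mono) auto
      moreover have "s k = u k + \<gamma> *\<^sub>R G (u k)"
        using DRS[of k] by (intro prox_differentiable_optimality[OF deriv \<gamma>(1)]) (simp add: DRS_def \<phi>1)
      then have "norm (s k) \<le> norm (u k) + \<gamma> * norm (G (u k))"
        using norm_triangle_ineq[of "u k" "\<gamma> *\<^sub>R G (u k)"] \<gamma> by simp
      ultimately show ?thesis
        using B[of k] by simp
    qed
    then have "bounded (range s)"
      by (auto simp: bounded_iff)
    then have "bounded (range s \<times> range u \<times> range v)"
      using bounded_u bounded_v by (intro bounded_Times)
    then show ?thesis
      by (rule bounded_subset) auto
  qed
qed

lemma strongly_convex_linesearch_convergence:
  fixes \<phi>1 \<phi>2 :: "'a::euclidean_space \<Rightarrow> ereal"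
  assumes strong: "strongly_convex_case \<mu> \<phi>1 \<phi>2" and params: "strongly_convex_params \<mu> \<phi>1 \<gamma> lam c"
    and lam: "0 < lam" "lam < 2"
    and iter: "linesearch_DRS (-1) \<gamma> lam c 0 imax \<phi>1 \<phi>2 s u v"
  shows "summable (\<lambda>k. (norm (u k - v k))\<^sup>2)"
    and "\<exists>x. argmin (\<lambda>x. \<phi>1 x + \<phi>2 x) = {x} \<and>
         incseq (\<lambda>k. DRE \<gamma> \<phi>1 \<phi>2 (s k)) \<and> (\<lambda>k. DRE \<gamma> \<phi>1 \<phi>2 (s k)) \<longlonglongrightarrow> \<phi>1 x + \<phi>2 x \<and>
         u \<longlonglongrightarrow> x \<and> v \<longlonglongrightarrow> x"
    and "0 \<in> interior (set_diff (eff_dom \<phi>1) (eff_dom \<phi>2)) \<longleftrightarrow>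
         level_bounded (\<lambda>y. conjugate \<phi>1 (- y) + conjugate \<phi>2 y)"
    and "0 \<in> interior (set_diff (eff_dom \<phi>1) (eff_dom \<phi>2)) \<Longrightarrow> bounded (range s)"
proof -
  have no_minf: "\<And>x. \<phi>1 x \<noteq> -\<infinity>" "\<And>x. \<phi>2 x \<noteq> -\<infinity>" and lsc: "lsc \<phi>1" "lsc \<phi>2"
    and conv: "convex_fun (\<lambda>x. \<phi>1 x - ereal (\<mu> / 2 * (norm x)\<^sup>2))" "convex_fun \<phi>2" and \<mu>: "0 < \<mu>"
    and rel: "0 \<in> rel_interior (set_diff (eff_dom \<phi>1) (eff_dom \<phi>2))"
    using strong by (auto simp: strongly_convex_case_def proper_fun_def strongly_convex_fun_def)
  have "1 / \<mu> < \<gamma>"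
    using params by (simp add: strongly_convex_params_def)
  moreover from this have "0 < \<gamma>"
    using \<mu> by (auto intro: less_trans[of 0 "1 / \<mu>"])
  ultimately have \<gamma>: "0 < \<gamma>" "1 / \<gamma> < \<mu>"
    using \<mu> by (auto simp: field_simps)
  define \<alpha> where "\<alpha> = 1 / (\<gamma> * \<mu>)"
  have \<alpha>: "0 < \<alpha>" "\<alpha> < 1"
    using \<gamma> \<mu> by (auto simp: \<alpha>_def field_simps)
  have c: "0 < c" "c < lam / (1 + \<alpha>)\<^sup>2 * ((2 - lam) / 2 - \<alpha> * max (\<alpha> - lam / 2) 0)"
  proof -
    show "0 < c"
      using params by (simp add: strongly_convex_params_def)
    \<comment> \<open>As \<open>\<alpha> < 1\<close>, the bound on \<open>c\<close> is weakest for the convex value of \<open>m\<close>, so it holds with this value.\<close>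
    define m where "m = (if convex_fun \<phi>1 then max (\<alpha> - lam / 2) 0 else 1)"
    have "c < lam / (1 + \<alpha>)\<^sup>2 * ((2 - lam) / 2 - \<alpha> * m)"
      using params unfolding strongly_convex_params_def C_const_def Let_def m_def \<alpha>_def by (elim conjE)
    also have "\<dots> \<le> lam / (1 + \<alpha>)\<^sup>2 * ((2 - lam) / 2 - \<alpha> * max (\<alpha> - lam / 2) 0)"
      using \<alpha> lam by (intro mult_left_mono diff_left_mono) (auto simp: m_def)
    finally show "c < lam / (1 + \<alpha>)\<^sup>2 * ((2 - lam) / 2 - \<alpha> * max (\<alpha> - lam / 2) 0)" .
  qed
  have DRS: "(u k, v k) \<in> DRS \<gamma> \<phi>1 \<phi>2 (s k)" for k
    by (rule linesearch_DRS_in_DRS[OF iter])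
  have DRE: "DRE \<gamma> \<phi>1 \<phi>2 s = ereal (envelope_at \<gamma> \<phi>1 \<phi>2 s u v)"
    if "(u, v) \<in> DRS \<gamma> \<phi>1 \<phi>2 s" for s u v
    by (rule DRE_eq_envelope_at[OF no_minf strongly_convex_prox_unique[OF no_minf(1) conv(1) \<mu> \<gamma>(1)] that])
  define E where "E k = envelope_at \<gamma> \<phi>1 \<phi>2 (s k) (u k) (v k)" for k
  have E: "DRE \<gamma> \<phi>1 \<phi>2 (s k) = ereal (E k)" for k
    unfolding E_def by (rule DRE[OF DRS])
  have nominal: "- 1 * envelope_at \<gamma> \<phi>1 \<phi>2 (s - lam *\<^sub>R (u - v)) u' v'
      \<le> - 1 * envelope_at \<gamma> \<phi>1 \<phi>2 s u v - c / \<gamma> * (norm (u - v))\<^sup>2"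
    if "(u, v) \<in> DRS \<gamma> \<phi>1 \<phi>2 s" "(u', v') \<in> DRS \<gamma> \<phi>1 \<phi>2 (s - lam *\<^sub>R (u - v))" for s u v u' v'
    using strongly_convex_envelope_increase[OF no_minf conv \<mu> \<gamma>(1) lam \<alpha>_def c that] by simp
  have step: "- E (Suc k) \<le> - E k - c / \<gamma> * (norm (u k - v k))\<^sup>2" for k
    using linesearch_DRS_merit_step[OF iter \<gamma>(1) DRE nominal] by (simp add: E_def)
  obtain x y a b where "0 = x - y" "\<phi>1 x = ereal a" "\<phi>2 y = ereal b"
    using set_diff_eff_domE[of 0 \<phi>1 \<phi>2] rel rel_interior_subset no_minf by (metis subsetD)
  then have ab: "\<phi>1 x = ereal a" "\<phi>2 x = ereal b"
    by auto
  have upper: "- (a + b) \<le> - E k" for k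
  proof -
    have "0 \<le> (\<mu> - 1 / \<gamma>) / 2 * (norm (x - u k))\<^sup>2"
      using \<gamma> by simp
    then show ?thesis
      using strongly_convex_envelope_gap[OF no_minf conv \<gamma>(1) DRS[of k] ab] unfolding E_def by linarith
  qed
  note merit = decreasing_merit_convergence[where E = "\<lambda>k. - E k" and a = "\<lambda>k. c / \<gamma> * (norm (u k - v k))\<^sup>2"
      and m = "- (a + b)", OF step _ upper]
  have "summable (\<lambda>k. c / \<gamma> * (norm (u k - v k))\<^sup>2)"
    using merit(1) c \<gamma> by simp
  then show summable: "summable (\<lambda>k. (norm (u k - v k))\<^sup>2)"
    using c \<gamma> summable_cmult_iff[of "c / \<gamma>" "\<lambda>k. (norm (u k - v k))\<^sup>2"] by simp
  have residual: "(\<lambda>k. u k - v k) \<longlonglongrightarrow> 0"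
    by (rule summable_norm_square_imp_null[OF summable])
  have "decseq (\<lambda>k. - E k)"
    using merit(2) c \<gamma> by simp
  then have mono: "incseq E"
    by (simp add: decseq_def incseq_def)
  then have "incseq (\<lambda>k. DRE \<gamma> \<phi>1 \<phi>2 (s k))"
    by (simp add: E incseq_def)
  then show "\<exists>x. argmin (\<lambda>x. \<phi>1 x + \<phi>2 x) = {x} \<and>
         incseq (\<lambda>k. DRE \<gamma> \<phi>1 \<phi>2 (s k)) \<and> (\<lambda>k. DRE \<gamma> \<phi>1 \<phi>2 (s k)) \<longlonglongrightarrow> \<phi>1 x + \<phi>2 x \<and>
         u \<longlonglongrightarrow> x \<and> v \<longlonglongrightarrow> x"
    using strongly_convex_splitting_convergence(1)[where s = s and u = u and v = v,
        OF no_minf lsc conv \<mu> \<gamma> rel DRS E_def mono residual]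
    unfolding E by blast
  show "0 \<in> interior (set_diff (eff_dom \<phi>1) (eff_dom \<phi>2)) \<longleftrightarrow>
         level_bounded (\<lambda>y. conjugate \<phi>1 (- y) + conjugate \<phi>2 y)"
    by (rule dual_level_bounded_iff[OF no_minf conv \<mu> \<gamma>(1) rel DRS])
  show "0 \<in> interior (set_diff (eff_dom \<phi>1) (eff_dom \<phi>2)) \<Longrightarrow> bounded (range s)"
    by (rule strongly_convex_splitting_convergence(2)[where s = s and u = u and v = v,
        OF no_minf lsc conv \<mu> \<gamma> rel DRS E_def mono residual])
qed

theorem theorem4p3:
  fixes \<phi>1 \<phi>2 \<phi> :: "real ^ 'p \<Rightarrow> ereal"
    and \<pi> L \<mu> \<gamma> lam c :: real
    and imax :: enat
    and s u v :: "nat \<Rightarrow> real ^ 'p"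
  assumes no_minf: "\<And>x. \<phi>1 x \<noteq> -\<infinity>" "\<And>x. \<phi>2 x \<noteq> -\<infinity>"
    and phi: "\<phi> = (\<lambda>x. \<phi>1 x + \<phi>2 x)"
    and cases: "(\<pi> = 1 \<and> smooth_case L \<phi>1 \<phi>2 \<and> smooth_params L \<phi>1 \<gamma> lam c) \<or>
                (\<pi> = -1 \<and> strongly_convex_case \<mu> \<phi>1 \<phi>2 \<and> strongly_convex_params \<mu> \<phi>1 \<gamma> lam c)"
    and relaxation: "0 < lam" "lam < 2"
    and iterates: "linesearch_DRS \<pi> \<gamma> lam c 0 imax \<phi>1 \<phi>2 s u v"
  shows "summable (\<lambda>k. (norm (u k - v k))\<^sup>2) \<and>
    (\<pi> = 1 \<longrightarrow>
      (cluster_points u = cluster_points v \<and>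
       decseq (\<lambda>k. DRE \<gamma> \<phi>1 \<phi>2 (s k)) \<and>
       (\<exists>l::real. (\<lambda>k. DRE \<gamma> \<phi>1 \<phi>2 (s k)) \<longlonglongrightarrow> ereal l \<and>
         (\<forall>ustar \<in> cluster_points u.
            0 \<in> limiting_subdiff \<phi> ustar \<and>
            \<phi> ustar = DRE \<gamma> \<phi>1 \<phi>2 (ustar + \<gamma> *\<^sub>R gradient (\<lambda>x. real_of_ereal (\<phi>1 x)) ustar) \<and>
            \<phi> ustar = ereal l))) \<and>
      (level_bounded \<phi> \<longrightarrow> bounded (range (\<lambda>k. (s k, u k, v k))))) \<and>
    (\<pi> = -1 \<longrightarrow>
      (\<exists>xstar. argmin \<phi> = {xstar} \<and>
         incseq (\<lambda>k. DRE \<gamma> \<phi>1 \<phi>2 (s k)) \<and> (\<lambda>k. DRE \<gamma> \<phi>1 \<phi>2 (s k)) \<longlonglongrightarrow> \<phi> xstar \<and>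
         u \<longlonglongrightarrow> xstar \<and> v \<longlonglongrightarrow> xstar) \<and>
      (0 \<in> interior (set_diff (eff_dom \<phi>1) (eff_dom \<phi>2)) \<longleftrightarrow>
         level_bounded (\<lambda>y. conjugate \<phi>1 (- y) + conjugate \<phi>2 y)) \<and>
      (0 \<in> interior (set_diff (eff_dom \<phi>1) (eff_dom \<phi>2)) \<longrightarrow> bounded (range s)))"
  using cases
proof (elim disjE conjE)
  assume "\<pi> = 1" "smooth_case L \<phi>1 \<phi>2" "smooth_params L \<phi>1 \<gamma> lam c"
  then show ?thesis
    using smooth_linesearch_convergence[of L \<phi>1 \<phi>2 \<gamma> lam c imax s u v] relaxation iterates
    unfolding phi by simp
next
  assume "\<pi> = -1" "strongly_convex_case \<mu> \<phi>1 \<phi>2" "strongly_convex_params \<mu> \<phi>1 \<gamma> lam c"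
  then show ?thesis
    using strongly_convex_linesearch_convergence[of \<mu> \<phi>1 \<phi>2 \<gamma> lam c imax s u v] relaxation iterates
    unfolding phi by simp
qed

end
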